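(* Let $G$ be a $G_\delta$ subset of $[0,1]$ with $1\in G$. Then there exists a continuous function $F:(\{0,1\}\times\{0,1\})^{\mathbb{N}}\to(\{0,1\}\times\{0,1\})^{\mathbb{N}}$ such that for $\epsilon\in[0,1]$ the computer perturbation $F_\epsilon$ is ergodic if and only if $\epsilon\in G$, and otherwise $F_\epsilon$ admits several invariant measures. Formally, $$\mathrm{Uni}(F)=\mathrm{Erg}(F)=G.$$
   Context: $\mathbb{N}=\{0,1,2,\dots\}$; $\mathcal{A}=\{0,1\}\times\{0,1\}$ and $\mathcal{A}^{\mathbb{N}}$ has the product topology and Borel $\sigma$-algebra. For a continuous $F:\mathcal{A}^{\mathbb{N}}\to\mathcal{A}^{\mathbb{N}}$ and $\epsilon\in[0,1]$, the computer perturbation $F_\epsilon$ of size $\epsilon$ is the probability kernel on $\mathcal{A}^{\mathbb{N}}$ such that for all $x\in\mathcal{A}^{\mathbb{N}}$, all finite $U\subset\mathbb{N}$ and all $\omega\in\mathcal{A}^U$, $$F_\epsilon(x,[\omega]_U)=\prod_{i\in U}\left((1-\epsilon)\mathbf{1}_{\omega_i=F(x)_i}+\frac{\epsilon}{|\mathcal{A}|}\right),\qquad [\omega]_U=\{y\in\mathcal{A}^{\mathbb{N}}: y_U=\omega\}.$$ It acts on Borel probability measures by $F_\epsilon\mu(A)=\int F_\epsilon(x,A)\,d\mu(x)$; $\mu$ is $F_\epsilon$-invariant if $F_\epsilon\mu=\mu$. $F_\epsilon$ is ergodic if it has a unique invariant probability measure $\pi$ and $F_\epsilon^n\mu\to\pi$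 weakly for every probability measure $\mu$. $\mathrm{Uni}(F)$ is the set of $\epsilon\in[0,1]$ such that $F_\epsilon$ has a unique invariant probability measure; $\mathrm{Erg}(F)$ is the set of $\epsilon\in[0,1]$ such that $F_\epsilon$ is ergodic. A $G_\delta$ subset of $[0,1]$ is a countable intersection of (relatively) open subsets of $[0,1]$. *)

theory Defs
  imports "HOL-Probability.Probability"
begin

type_synonym letter = "bool \<times> bool"
type_synonym config = "nat \<Rightarrow> letter"

(* The Borel sets of config come from the product topology on functions; making bool second
   countable lets the library identify them with the product sigma-algebra. *)
instance bool :: second_countable_topology
proof
  have "open = generate_topology (UNIV :: bool set set)"
  proof
    fix S :: "bool set"
    show "open S = generate_topology UNIV S"
      by (simp add: discrete_topology_class.open_discrete generate_topology.Basis)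
  qed
  then show "\<exists>B::bool set set. countable B \<and> open = generate_topology B"
    by (intro exI[of _ UNIV]) simp
qed

(* A word in letter^U is represented by any total extension w; only its values on U matter. *)
definition cylinder :: "nat set \<Rightarrow> config \<Rightarrow> config set" where
  "cylinder U w = {y. \<forall>i\<in>U. y i = w i}"

definition is_computer_perturbation ::
    "(config \<Rightarrow> config) \<Rightarrow> real \<Rightarrow> (config \<Rightarrow> config measure) \<Rightarrow> bool" where
  "is_computer_perturbation F \<epsilon> K \<longleftrightarrow>
     K \<in> borel \<rightarrow>\<^sub>M prob_algebra borel \<and>
     (\<forall>x U w. finite U \<longrightarrow>
        measure (K x) (cylinder U w) =
          (\<Prod>i\<in>U. (1 - \<epsilon>) * of_bool (w i = F x i) + \<epsilon> / real CARD(letter)))"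

(* Well defined for continuous F and 0 <= \<epsilon> <= 1: see ex1_computer_perturbation. *)
definition perturbation :: "(config \<Rightarrow> config) \<Rightarrow> real \<Rightarrow> config \<Rightarrow> config measure" where
  "perturbation F \<epsilon> = (THE K. is_computer_perturbation F \<epsilon> K)"

abbreviation borel_probs :: "'a::topological_space measure set" where
  "borel_probs \<equiv> space (prob_algebra borel)"

(* The action of a kernel on measures is the library's Giry bind: see emeasure_kernel_action. *)
definition kernel_action :: "(config \<Rightarrow> config measure) \<Rightarrow> config measure \<Rightarrow> config measure" where
  "kernel_action K \<mu> = \<mu> \<bind> K"

definition invariant_probs :: "(config \<Rightarrow> config measure) \<Rightarrow> config measure set" where
  "invariant_probs K = {\<mu> \<in> borel_probs. kernel_action K \<mu> = \<mu>}"

(* The library's weak_conv_m is restricted to measures on the real line. *)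
definition converges_weakly :: "(nat \<Rightarrow> 'a::topological_space measure) \<Rightarrow> 'a measure \<Rightarrow> bool" where
  "converges_weakly M N \<longleftrightarrow>
     (\<forall>f :: 'a \<Rightarrow> real. continuous_on UNIV f \<longrightarrow> bounded (range f) \<longrightarrow>
        (\<lambda>n. \<integral>x. f x \<partial>M n) \<longlonglongrightarrow> (\<integral>x. f x \<partial>N))"

definition uniquely_ergodic :: "(config \<Rightarrow> config measure) \<Rightarrow> bool" where
  "uniquely_ergodic K \<longleftrightarrow> (\<exists>!\<pi>. \<pi> \<in> invariant_probs K)"

definition ergodic :: "(config \<Rightarrow> config measure) \<Rightarrow> bool" where
  "ergodic K \<longleftrightarrow>
     (\<exists>\<pi>. invariant_probs K = {\<pi>} \<and>
        (\<forall>\<mu>\<in>borel_probs. converges_weakly (\<lambda>n. (kernel_action K ^^ n) \<mu>) \<pi>))"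

definition Uni :: "(config \<Rightarrow> config) \<Rightarrow> real set" where
  "Uni F = {\<epsilon>\<in>{0..1}. uniquely_ergodic (perturbation F \<epsilon>)}"

definition Erg :: "(config \<Rightarrow> config) \<Rightarrow> real set" where
  "Erg F = {\<epsilon>\<in>{0..1}. ergodic (perturbation F \<epsilon>)}"

lemma sets_borel_letter: "sets (borel :: letter measure) = UNIV"
proof -
  have "A \<in> sets (borel :: letter measure)" for A :: "letter set"
  proof (rule borel_closed)
    show "closed A" by (rule finite_imp_closed) simp
  qed
  then show ?thesis by blast
qed

lemma sets_PiM_letter:
  "sets (PiM UNIV (\<lambda>i::nat. measure_pmf (p i :: letter pmf))) = sets (borel :: config measure)"
proof -
  have "sets (PiM UNIV (\<lambda>i::nat. measure_pmf (p i :: letter pmf)))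
      = sets (PiM UNIV (\<lambda>i::nat. (borel :: letter measure)))"
    by (rule sets_PiM_cong) (simp_all add: sets_borel_letter)
  then show ?thesis by (simp add: sets_PiM_equal_borel)
qed

lemma cylinder_borel:
  assumes "finite U" shows "cylinder U w \<in> sets (borel :: config measure)"
proof -
  have "closed (cylinder U w)"
  proof -
    have "cylinder U w = (\<Inter>i\<in>U. (\<lambda>y. y i) -` {w i})"
      by (auto simp: cylinder_def)
    moreover have "closed ((\<lambda>y::config. y i) -` {w i})" for i
      by (rule closed_vimage) (auto intro: continuous_on_product_coordinates)
    ultimately show ?thesis by auto
  qed
  then show ?thesis by simp
qed

lemma box_eq_cylinders:
  "{y::config. \<forall>i\<in>U. y i \<in> A i} = (\<Union>w\<in>Pi\<^sub>E U A. cylinder U w)"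
proof (intro equalityI subsetI)
  fix y :: config assume "y \<in> {y. \<forall>i\<in>U. y i \<in> A i}"
  then have "restrict y U \<in> Pi\<^sub>E U A" "y \<in> cylinder U (restrict y U)"
    by (auto simp: cylinder_def)
  then show "y \<in> (\<Union>w\<in>Pi\<^sub>E U A. cylinder U w)" by blast
qed (auto simp: cylinder_def PiE_def Pi_def)

lemma config_measure_eqI:
  assumes M: "M \<in> borel_probs" and N: "N \<in> borel_probs"
    and eq: "\<And>U w. finite U \<Longrightarrow> measure M (cylinder U w) = measure N (cylinder U w)"
  shows "M = (N :: config measure)"
proof -
  have sM: "sets M = sets borel" "prob_space M" and sN: "sets N = sets borel" "prob_space N"
    using M N by (auto simp: space_prob_algebra)
  interpret M: prob_space M by fact
  interpret N: prob_space N by fact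
  have P: "sets (PiM UNIV (\<lambda>i::nat. (borel :: letter measure))) = sets (borel :: config measure)"
    by (rule sets_PiM_equal_borel)
  have disj: "disjoint_family_on (cylinder U) (Pi\<^sub>E U A)" for U and A :: "nat \<Rightarrow> letter set"
    unfolding disjoint_family_on_def cylinder_def
  proof (intro ballI impI)
    fix v w assume *: "v \<in> Pi\<^sub>E U A" "w \<in> Pi\<^sub>E U A" "v \<noteq> w"
    have "\<exists>i\<in>U. v i \<noteq> w i"
      using PiE_ext[OF *(1,2)] *(3) by blast
    then show "{y. \<forall>i\<in>U. y i = v i} \<inter> {y. \<forall>i\<in>U. y i = w i} = {}"
      by auto
  qed
  have box: "emeasure L {y. \<forall>i\<in>U. y i \<in> A i} = (\<Sum>w\<in>Pi\<^sub>E U A. emeasure L (cylinder U w))"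
    if "finite U" "sets L = sets borel" for U and A :: "nat \<Rightarrow> letter set" and L :: "config measure"
    unfolding box_eq_cylinders
  proof (rule sum_emeasure[symmetric])
    show "cylinder U ` Pi\<^sub>E U A \<subseteq> sets L"
      using that by (auto intro: cylinder_borel)
    show "finite (Pi\<^sub>E U A)"
      using that(1) by (rule finite_PiE) simp
  qed (rule disj)
  show ?thesis
  proof (rule measure_eqI_PiM_infinite[where I = UNIV and M = "\<lambda>_. borel"])
    show "sets M = sets (PiM UNIV (\<lambda>i::nat. (borel :: letter measure)))" using sM P by simp
    show "sets N = sets (PiM UNIV (\<lambda>i::nat. (borel :: letter measure)))" using sN P by simp
    show "finite_measure M" by unfold_locales
    fix A :: "nat \<Rightarrow> letter set" and J :: "nat set" assume J: "finite J"
    have e: "prod_emb UNIV (\<lambda>_. borel :: letter measure) J (Pi\<^sub>E J A) = {y. \<forall>i\<in>J. y i \<in> A i}"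
      by (auto simp: prod_emb_def PiE_def Pi_def)
    show "emeasure M (prod_emb UNIV (\<lambda>_. borel) J (Pi\<^sub>E J A))
        = emeasure N (prod_emb UNIV (\<lambda>_. borel) J (Pi\<^sub>E J A))"
      unfolding e using box[OF J sM(1)] box[OF J sN(1)] eq[OF J]
      by (simp add: M.emeasure_eq_measure N.emeasure_eq_measure)
  qed
qed

definition letter_noise :: "real \<Rightarrow> letter \<Rightarrow> letter pmf" where
  "letter_noise \<epsilon> a =
     bernoulli_pmf \<epsilon> \<bind> (\<lambda>b. if b then pmf_of_set UNIV else return_pmf a)"

lemma pmf_letter_noise:
  assumes "0 \<le> \<epsilon>" "\<epsilon> \<le> 1"
  shows "pmf (letter_noise \<epsilon> a) b = (1 - \<epsilon>) * of_bool (b = a) + \<epsilon> / real CARD(letter)"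
  using assms by (auto simp: letter_noise_def pmf_bind indicator_def)

lemma is_computer_perturbation_PiM:
  assumes F: "continuous_on UNIV F" and \<epsilon>: "0 \<le> \<epsilon>" "\<epsilon> \<le> 1"
  shows "is_computer_perturbation F \<epsilon> (\<lambda>x. PiM UNIV (\<lambda>i. measure_pmf (letter_noise \<epsilon> (F x i))))"
    (is "is_computer_perturbation F \<epsilon> ?K")
proof -
  have Fi: "(\<lambda>x. F x i) \<in> borel \<rightarrow>\<^sub>M (count_space UNIV :: letter measure)" for i
  proof -
    have "continuous_on UNIV (\<lambda>x. F x i)"
      using F by (rule continuous_on_product_then_coordinatewise)
    then have "(\<lambda>x. F x i) \<in> borel \<rightarrow>\<^sub>M (borel :: letter measure)"
      by (rule borel_measurable_continuous_onI)
    moreover have "sets (count_space UNIV) = sets (borel :: letter measure)"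
      by (simp add: sets_borel_letter)
    ultimately show ?thesis using measurable_cong_sets[OF refl] by blast
  qed
  have prob: "prob_space (?K x)" for x
    by (rule prob_space_PiM) (rule prob_space_measure_pmf)
  have emb: "emeasure (?K x) (prod_emb UNIV (\<lambda>_. borel) J (Pi\<^sub>E J A))
      = (\<Prod>i\<in>J. emeasure (measure_pmf (letter_noise \<epsilon> (F x i))) (A i))"
    if "finite J" for x J and A :: "nat \<Rightarrow> letter set"
  proof -
    have "prod_emb UNIV (\<lambda>_. borel) J (Pi\<^sub>E J A)
        = prod_emb UNIV (\<lambda>i. measure_pmf (letter_noise \<epsilon> (F x i))) J (Pi\<^sub>E J A)"
      by (simp add: prod_emb_def)
    then show ?thesis
      using that by (simp add: emeasure_PiM_emb prob_space_measure_pmf)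
  qed
  have meas: "?K \<in> borel \<rightarrow>\<^sub>M prob_algebra borel"
  proof (rule measurable_prob_algebra_generated[where
        \<Omega> = "\<Pi>\<^sub>E i\<in>(UNIV::nat set). space (borel :: letter measure)"
        and G = "prod_algebra UNIV (\<lambda>_::nat. borel :: letter measure)"])
    show "sets (borel :: config measure) = sigma_sets (\<Pi>\<^sub>E i\<in>(UNIV::nat set). space (borel :: letter measure))
        (prod_algebra UNIV (\<lambda>_::nat. borel :: letter measure))"
      by (simp only: sets_PiM_equal_borel[symmetric] sets_PiM)
    show "Int_stable (prod_algebra UNIV (\<lambda>_::nat. borel :: letter measure))"
      by (rule Int_stable_prod_algebra)
    show "prod_algebra UNIV (\<lambda>_::nat. borel :: letter measure)
        \<subseteq> Pow (\<Pi>\<^sub>E i\<in>(UNIV::nat set). space (borel :: letter measure))"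
      by (rule prod_algebra_sets_into_space)
    show "prob_space (?K a)" for a by (rule prob)
    show "sets (?K a) = sets borel" for a by (rule sets_PiM_letter)
    fix B assume "B \<in> prod_algebra UNIV (\<lambda>_::nat. borel :: letter measure)"
    then obtain J A where B: "B = prod_emb UNIV (\<lambda>_. borel) J (Pi\<^sub>E J A)" and J: "finite J"
      by (rule prod_algebraE)
    have "(\<lambda>x. emeasure (measure_pmf (letter_noise \<epsilon> (F x i))) (A i)) \<in> borel_measurable borel" for i
      using Fi by (rule measurable_compose) simp
    then show "(\<lambda>x. emeasure (?K x) B) \<in> borel_measurable borel"
      unfolding B emb[OF J] by (rule borel_measurable_prod_ennreal)
  qed
  have "measure (?K x) (cylinder U w) =
      (\<Prod>i\<in>U. (1 - \<epsilon>) * of_bool (w i = F x i) + \<epsilon> / real CARD(letter))"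
    if U: "finite U" for x U w
  proof -
    have c: "cylinder U w = prod_emb UNIV (\<lambda>_. borel) U (Pi\<^sub>E U (\<lambda>i. {w i}))"
      by (auto simp: prod_emb_def cylinder_def PiE_def Pi_def)
    have "emeasure (?K x) (cylinder U w) = (\<Prod>i\<in>U. ennreal (pmf (letter_noise \<epsilon> (F x i)) (w i)))"
      unfolding c emb[OF U] by (simp add: emeasure_pmf_single)
    also have "\<dots> = ennreal (\<Prod>i\<in>U. pmf (letter_noise \<epsilon> (F x i)) (w i))"
      by (simp add: prod_ennreal)
    finally show ?thesis
      unfolding pmf_letter_noise[OF \<epsilon>, symmetric] by (simp add: measure_def prod_nonneg)
  qed
  with meas show ?thesis unfolding is_computer_perturbation_def by blast
qed

lemma ex1_computer_perturbation:
  assumes "continuous_on UNIV F" "0 \<le> \<epsilon>" "\<epsilon> \<le> 1"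
  shows "\<exists>!K. is_computer_perturbation F \<epsilon> K"
proof (rule ex_ex1I)
  show "\<exists>K. is_computer_perturbation F \<epsilon> K"
    using is_computer_perturbation_PiM[OF assms] by blast
  fix K L assume K: "is_computer_perturbation F \<epsilon> K" and L: "is_computer_perturbation F \<epsilon> L"
  show "K = L"
  proof
    fix x
    show "K x = L x"
    proof (rule config_measure_eqI)
      have "K \<in> borel \<rightarrow>\<^sub>M prob_algebra borel" "L \<in> borel \<rightarrow>\<^sub>M prob_algebra borel"
        using K L by (auto simp: is_computer_perturbation_def)
      then show "K x \<in> borel_probs" "L x \<in> borel_probs"
        by (auto dest!: measurable_space[where x = x])
      show "measure (K x) (cylinder U w) = measure (L x) (cylinder U w)" if "finite U" for U w
        using K L that by (simp add: is_computer_perturbation_def)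
    qed
  qed
qed

lemma is_computer_perturbation_perturbation:
  assumes "continuous_on UNIV F" "0 \<le> \<epsilon>" "\<epsilon> \<le> 1"
  shows "is_computer_perturbation F \<epsilon> (perturbation F \<epsilon>)"
  unfolding perturbation_def using ex1_computer_perturbation[OF assms] by (rule theI')

lemma emeasure_kernel_action:
  assumes "\<mu> \<in> borel_probs" "K \<in> borel \<rightarrow>\<^sub>M prob_algebra borel" "A \<in> sets borel"
  shows "emeasure (kernel_action K \<mu>) A = (\<integral>\<^sup>+x. emeasure (K x) A \<partial>\<mu>)"
  unfolding kernel_action_def using assms by (rule emeasure_bind_prob_algebra)

end

theory Submission
  imports Defs
begin

text \<open>
  Write the complement of \<open>G\<close> as a union of closed sets \<open>C n\<close>. The cells are partitioned into
  levels \<open>(n, k)\<close>, and every cell of level \<open>(n, k)\<close> copies one bit, the signal of level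
  \<open>(n, k + 1)\<close>. After one step the first track is a sample of the noise, so its frequencies estimate
  \<open>\<epsilon>\<close>; the signal of level \<open>(n, k)\<close> is the majority bit of the second track, provided this
  estimate is within \<open>(1/2) ^ k\<close> of \<open>C n\<close>, and false otherwise.

  If \<open>\<epsilon>\<close> lies in \<open>C n\<close>, then \<open>\<epsilon> < 1\<close> and the probabilities of misreading a bit are summable in
  \<open>k\<close>, so system \<open>n\<close> can transport either bit from infinity and has two equilibria. If \<open>\<epsilon>\<close> lies in
  no \<open>C n\<close>, the test fails with high probability at all deep levels of every system, and the
  initial condition is forgotten.

  Information flows strictly from level \<open>(n, k + 1)\<close> to level \<open>(n, k)\<close>, so distinct levels stay
  independent and the law of the process reduces to a scalar affine recursion for the probability
  of a true bit at each level.
\<close>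


section \<open>Functions of finitely many coordinates\<close>

definition depends_on :: "nat set \<Rightarrow> (config \<Rightarrow> 'a) \<Rightarrow> bool" where
  "depends_on U f \<longleftrightarrow> (\<forall>x y. (\<forall>i\<in>U. x i = y i) \<longrightarrow> f x = f y)"

lemma depends_onD: "depends_on U f \<Longrightarrow> (\<And>i. i \<in> U \<Longrightarrow> x i = y i) \<Longrightarrow> f x = f y"
  unfolding depends_on_def by blast

lemma depends_on_comp: "depends_on U f \<Longrightarrow> depends_on U (\<lambda>x. g (f x))"
  unfolding depends_on_def by metis

lemma depends_on_mult:
  "depends_on U f \<Longrightarrow> depends_on V g \<Longrightarrow> depends_on (U \<union> V) (\<lambda>x. f x * g x)"
  unfolding depends_on_def by (metis UnI1 UnI2)

lemma depends_on_cmult: "depends_on U f \<Longrightarrow> depends_on U (\<lambda>x. c * f x)"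
  by (rule depends_on_comp)

lemma depends_on_prod:
  assumes "\<And>j. j \<in> S \<Longrightarrow> depends_on (U j) (f j)"
  shows "depends_on (\<Union>j\<in>S. U j) (\<lambda>x. \<Prod>j\<in>S. f j x)"
  unfolding depends_on_def
proof (intro allI impI prod.cong refl)
  fix x y :: config and j assume "\<forall>i\<in>\<Union>(U ` S). x i = y i" "j \<in> S"
  then show "f j x = f j y" by (intro depends_onD[OF assms]) auto
qed

lemma depends_on_indicator_cylinder: "depends_on U (indicator (cylinder U w))"
  by (auto simp: depends_on_def indicator_def cylinder_def)

lemma finite_words: "finite U \<Longrightarrow> finite (Pi\<^sub>E U (\<lambda>_. UNIV :: letter set))"
  by (rule finite_PiE) simp_all

text \<open>Words are normalised to \<open>undefined\<close> off \<open>U\<close>, so exactly one of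
  them, \<open>restrict x U\<close>, has x in its cylinder. Measurability, integrability and
  integrals thereby reduce to cylinders, on which the kernels are specified.\<close>

lemma depends_on_expand:
  fixes f :: "config \<Rightarrow> real"
  assumes U: "finite U" and f: "depends_on U f"
  shows "f x = (\<Sum>w\<in>Pi\<^sub>E U (\<lambda>_. UNIV). f w * indicator (cylinder U w) x)"
proof -
  let ?W = "Pi\<^sub>E U (\<lambda>_. UNIV :: letter set)"
  have *: "f w * indicator (cylinder U w) x = (if restrict x U = w then f x else 0)" if w: "w \<in> ?W" for w
  proof (cases "restrict x U = w")
    case True
    then have "f w = f x" by (intro depends_onD[OF f]) auto
    then show ?thesis using True by (auto simp: cylinder_def)
  next
    case False
    then have "x \<notin> cylinder U w"
      using w PiE_ext[OF _ w, of "restrict x U"] by (auto simp: cylinder_def)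
    then show ?thesis using False by simp
  qed
  have "(\<Sum>w\<in>?W. f w * indicator (cylinder U w) x) = (\<Sum>w\<in>?W. if restrict x U = w then f x else 0)"
    by (rule sum.cong[OF refl *])
  also have "\<dots> = f x"
    using finite_words[OF U] by simp
  finally show ?thesis by simp
qed

lemma borel_measurable_depends_on:
  fixes f :: "config \<Rightarrow> real"
  assumes "finite U" "depends_on U f"
  shows "f \<in> borel_measurable borel"
proof -
  have "f = (\<lambda>x. \<Sum>w\<in>Pi\<^sub>E U (\<lambda>_. UNIV). f w * indicator (cylinder U w) x)"
    using depends_on_expand[OF assms] by blast
  moreover have "\<dots> \<in> borel_measurable borel"
    using cylinder_borel[OF assms(1)] by measurable
  ultimately show ?thesis by simp
qed

lemma borel_probsD:
  assumes "M \<in> borel_probs"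
  shows "prob_space M" "sets M = sets borel" "space M = UNIV"
  using assms sets_eq_imp_space_eq[of M borel] by (auto simp: space_prob_algebra)

lemma integrable_depends_on:
  fixes f :: "config \<Rightarrow> real"
  assumes M: "M \<in> borel_probs" and U: "finite U" and f: "depends_on U f"
  shows "integrable M f"
proof -
  interpret prob_space M using borel_probsD[OF M] by simp
  have m: "cylinder U w \<in> sets M" for w
    using cylinder_borel[OF U] borel_probsD[OF M] by simp
  have "integrable M (\<lambda>x. \<Sum>w\<in>Pi\<^sub>E U (\<lambda>_. UNIV). f w * indicator (cylinder U w) x)"
    by (intro Bochner_Integration.integrable_sum integrable_mult_right integrable_real_indicator m)
      (simp add: emeasure_eq_measure)
  then show ?thesis by (rule back_subst[of "integrable M"]) (rule ext, rule depends_on_expand[OF U f, symmetric])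
qed

lemma integral_depends_on:
  fixes f :: "config \<Rightarrow> real"
  assumes M: "M \<in> borel_probs" and U: "finite U" and f: "depends_on U f"
  shows "(\<integral>x. f x \<partial>M) = (\<Sum>w\<in>Pi\<^sub>E U (\<lambda>_. UNIV). f w * measure M (cylinder U w))"
proof -
  interpret prob_space M using borel_probsD[OF M] by simp
  have m: "cylinder U w \<in> sets M" for w
    using cylinder_borel[OF U] borel_probsD[OF M] by simp
  have "(\<integral>x. f x \<partial>M) = (\<integral>x. (\<Sum>w\<in>Pi\<^sub>E U (\<lambda>_. UNIV). f w * indicator (cylinder U w) x) \<partial>M)"
    by (intro Bochner_Integration.integral_cong refl depends_on_expand[OF U f])
  also have "\<dots> = (\<Sum>w\<in>Pi\<^sub>E U (\<lambda>_. UNIV). \<integral>x. f w * indicator (cylinder U w) x \<partial>M)"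
    by (intro Bochner_Integration.integral_sum integrable_mult_right integrable_real_indicator m)
      (simp add: emeasure_eq_measure)
  finally show ?thesis using m by (simp add: Int_absorb1 sets.sets_into_space)
qed

lemma kernel_action_borel_probs:
  assumes "\<mu> \<in> borel_probs" "K \<in> borel \<rightarrow>\<^sub>M prob_algebra borel"
  shows "kernel_action K \<mu> \<in> borel_probs"
  using sets_bind'[OF assms] prob_space_bind'[OF assms]
  unfolding kernel_action_def space_prob_algebra by blast

lemma integral_kernel_action:
  fixes f :: "config \<Rightarrow> real"
  assumes \<mu>: "\<mu> \<in> borel_probs" and K: "K \<in> borel \<rightarrow>\<^sub>M prob_algebra borel"
    and f: "f \<in> borel_measurable borel" "\<And>x. \<bar>f x\<bar> \<le> B"
  shows "(\<integral>x. f x \<partial>kernel_action K \<mu>) = (\<integral>x. (\<integral>y. f y \<partial>K x) \<partial>\<mu>)"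
proof -
  have b: "K \<in> \<mu> \<rightarrow>\<^sub>M subprob_algebra borel"
    using K measurable_cong_sets[OF borel_probsD(2)[OF \<mu>] refl] by (blast intro: measurable_prob_algebraD)
  interpret prob_space \<mu> using borel_probsD[OF \<mu>] by simp
  have "emeasure (K x) (space (K x)) \<le> ennreal 1" if "x \<in> space \<mu>" for x
    using measurable_space[OF b that] by (auto simp: space_subprob_algebra subprob_space.subprob_emeasure_le_1)
  then show ?thesis
    unfolding kernel_action_def using f b
    by (intro integral_bind[where B = B and B' = 1]) (auto simp: borel_probsD[OF \<mu>] finite_measure_axioms)
qed

section \<open>Laws with independent coordinates\<close>

definition product_law :: "(nat \<Rightarrow> letter \<Rightarrow> real) \<Rightarrow> config measure \<Rightarrow> bool" where
  "product_law q M \<longleftrightarrow> M \<in> borel_probs \<and>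
     (\<forall>U w. finite U \<longrightarrow> measure M (cylinder U w) = (\<Prod>i\<in>U. q i (w i)))"

lemma product_lawD:
  assumes "product_law q M"
  shows "M \<in> borel_probs" "finite U \<Longrightarrow> measure M (cylinder U w) = (\<Prod>i\<in>U. q i (w i))"
  using assms by (auto simp: product_law_def)

text \<open>Both integrals are the same finite sum over cylinders. This lets
  \<open>block_law\<close> replace the law of a perturbation on a single level.\<close>

lemma product_law_integral_cong:
  fixes f :: "config \<Rightarrow> real"
  assumes "product_law q M" "product_law r N" "finite U" "depends_on U f" "\<And>i. i \<in> U \<Longrightarrow> q i = r i"
  shows "(\<integral>x. f x \<partial>M) = (\<integral>x. f x \<partial>N)"
  using assms by (auto simp: integral_depends_on[OF product_lawD(1)] product_lawD(2) intro!: sum.cong prod.cong)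

text \<open>Cylinders over disjoint sets meet in a cylinder over the union, whose measure factors.
  The general case follows by bilinearity from the expansions of f and g.\<close>

lemma product_law_integral_mult:
  fixes f g :: "config \<Rightarrow> real"
  assumes P: "product_law q M" and U: "finite U" "depends_on U f" and V: "finite V" "depends_on V g"
    and disj: "U \<inter> V = {}"
  shows "(\<integral>x. f x * g x \<partial>M) = (\<integral>x. f x \<partial>M) * (\<integral>x. g x \<partial>M)"
proof -
  note M = product_lawD(1)[OF P]
  interpret prob_space M using borel_probsD[OF M] by simp
  let ?W = "\<lambda>U. Pi\<^sub>E U (\<lambda>_. UNIV :: letter set)"
  have m: "cylinder X w \<in> sets M" if "finite X" for X w
    using cylinder_borel[OF that] borel_probsD[OF M] by simp
  have meas: "measure M (cylinder U w \<inter> cylinder V z) = measure M (cylinder U w) * measure M (cylinder V z)" for w z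
  proof -
    \<comment> \<open>The word on the union, glued from w and z.\<close>
    define u where "u i = (if i \<in> U then w i else z i)" for i
    have "cylinder U w \<inter> cylinder V z = cylinder (U \<union> V) u"
      using disj by (auto simp: cylinder_def u_def)
    moreover have "(\<Prod>i\<in>U. q i (u i)) = (\<Prod>i\<in>U. q i (w i))" "(\<Prod>i\<in>V. q i (u i)) = (\<Prod>i\<in>V. q i (z i))"
      using disj by (auto simp: u_def intro!: prod.cong)
    ultimately show ?thesis
      using U V disj by (simp add: product_lawD(2)[OF P] prod.union_disjoint)
  qed
  have i: "integrable M (\<lambda>x. f w * indicator (cylinder U w) x * (g z * indicator (cylinder V z) x))" for w z
  proof (rule integrable_depends_on[OF M])
    show "depends_on (U \<union> V) (\<lambda>x. f w * indicator (cylinder U w) x * (g z * indicator (cylinder V z) x))"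
      by (intro depends_on_mult depends_on_cmult depends_on_indicator_cylinder)
  qed (use U V in simp)
  have "(\<integral>x. f x * g x \<partial>M) = (\<integral>x. (\<Sum>w\<in>?W U. \<Sum>z\<in>?W V.
      f w * indicator (cylinder U w) x * (g z * indicator (cylinder V z) x)) \<partial>M)"
    by (intro Bochner_Integration.integral_cong refl)
      (subst depends_on_expand[OF U], subst depends_on_expand[OF V], simp add: sum_product)
  also have "\<dots> = (\<Sum>w\<in>?W U. \<Sum>z\<in>?W V. \<integral>x. f w * indicator (cylinder U w) x * (g z * indicator (cylinder V z) x) \<partial>M)"
    by (simp add: Bochner_Integration.integral_sum i Bochner_Integration.integrable_sum)
  also have "\<dots> = (\<Sum>w\<in>?W U. \<Sum>z\<in>?W V. f w * measure M (cylinder U w) * (g z * measure M (cylinder V z)))"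
  proof (intro sum.cong refl)
    fix w z
    have "(\<integral>x. f w * indicator (cylinder U w) x * (g z * indicator (cylinder V z) x) \<partial>M)
        = (\<integral>x. (f w * g z) * indicator (cylinder U w \<inter> cylinder V z) x \<partial>M)"
      by (intro Bochner_Integration.integral_cong) (auto simp: indicator_def)
    also have "\<dots> = f w * g z * measure M (cylinder U w \<inter> cylinder V z)"
      using m U V by (simp add: Int_absorb1 sets.sets_into_space sets.Int)
    finally show "(\<integral>x. f w * indicator (cylinder U w) x * (g z * indicator (cylinder V z) x) \<partial>M)
        = f w * measure M (cylinder U w) * (g z * measure M (cylinder V z))"
      unfolding meas by simp
  qed
  finally show ?thesis
    unfolding integral_depends_on[OF M U] integral_depends_on[OF M V] by (simp add: sum_product)
qed

lemma product_law_integral_prod: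
  fixes f :: "'i \<Rightarrow> config \<Rightarrow> real"
  assumes P: "product_law q M" and S: "finite S"
    and U: "\<And>j. j \<in> S \<Longrightarrow> finite (U j)" "\<And>j. j \<in> S \<Longrightarrow> depends_on (U j) (f j)"
    and disj: "disjoint_family_on U S"
  shows "(\<integral>x. (\<Prod>j\<in>S. f j x) \<partial>M) = (\<Prod>j\<in>S. \<integral>x. f j x \<partial>M)"
  using S U disj
proof (induction S)
  case empty
  interpret prob_space M using borel_probsD[OF product_lawD(1)[OF P]] by simp
  show ?case by (simp add: prob_space)
next
  case (insert j S)
  have "(\<integral>x. f j x * (\<Prod>j\<in>S. f j x) \<partial>M) = (\<integral>x. f j x \<partial>M) * (\<integral>x. (\<Prod>j\<in>S. f j x) \<partial>M)"
  proof (rule product_law_integral_mult[OF P])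
    show "depends_on (\<Union>j\<in>S. U j) (\<lambda>x. \<Prod>j\<in>S. f j x)"
      using insert by (intro depends_on_prod) auto
    show "U j \<inter> (\<Union>j\<in>S. U j) = {}"
      using insert by (auto simp: disjoint_family_on_def)
  qed (use insert in auto)
  also have "(\<integral>x. (\<Prod>j\<in>S. f j x) \<partial>M) = (\<Prod>j\<in>S. \<integral>x. f j x \<partial>M)"
    using insert by (intro insert.IH) (auto simp: disjoint_family_on_def)
  finally show ?case using insert by simp
qed

lemma product_law_exists:
  "product_law (\<lambda>i. pmf (r i)) (PiM UNIV (\<lambda>i::nat. measure_pmf (r i :: letter pmf)))"
    (is "product_law _ ?M")
  unfolding product_law_def
proof (intro conjI allI impI)
  have "prob_space ?M" by (rule prob_space_PiM) (rule prob_space_measure_pmf)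
  then show "?M \<in> borel_probs" by (simp add: space_prob_algebra sets_PiM_letter)
  fix U :: "nat set" and w :: config assume U: "finite U"
  have c: "cylinder U w = prod_emb UNIV (\<lambda>i. measure_pmf (r i)) U (Pi\<^sub>E U (\<lambda>i. {w i}))"
    by (auto simp: prod_emb_def cylinder_def PiE_def Pi_def)
  have "emeasure ?M (cylinder U w) = (\<Prod>i\<in>U. ennreal (pmf (r i) (w i)))"
    unfolding c using U by (simp add: emeasure_PiM_emb prob_space_measure_pmf emeasure_pmf_single)
  also have "\<dots> = ennreal (\<Prod>i\<in>U. pmf (r i) (w i))"
    by (simp add: prod_ennreal)
  finally show "measure ?M (cylinder U w) = (\<Prod>i\<in>U. pmf (r i) (w i))"
    by (simp add: measure_def prod_nonneg)
qed

section \<open>Topology of the configuration space and weak convergence\<close>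

lemma open_cylinder:
  assumes "finite U" shows "open (cylinder U w)"
proof -
  have "cylinder U w = (\<Inter>i\<in>U. (\<lambda>y. y i) -` {w i})"
    by (auto simp: cylinder_def)
  moreover have "open ((\<lambda>y::config. y i) -` {w i})" for i
  proof (rule open_vimage)
    have "closed (- {w i})" by (rule finite_imp_closed) simp
    then show "open {w i}" by (simp add: closed_def)
  qed (auto intro: continuous_on_product_coordinates)
  ultimately show ?thesis using assms by auto
qed

lemma continuous_on_depends_on:
  fixes F :: "config \<Rightarrow> config"
  assumes "\<And>i. finite (U i)" "\<And>i. depends_on (U i) (\<lambda>x. F x i)"
  shows "continuous_on UNIV F"
proof (rule continuous_on_coordinatewise_then_product)
  fix i
  have "open ((\<lambda>x. F x i) -` B)" for B
  proof -
    have "F x i = F w i" if "x \<in> cylinder (U i) w" for x w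
      using that by (intro depends_onD[OF assms(2)]) (simp add: cylinder_def)
    then have "(\<Union>w\<in>(\<lambda>x. F x i) -` B. cylinder (U i) w) \<subseteq> (\<lambda>x. F x i) -` B"
      by fastforce
    then have "(\<lambda>x. F x i) -` B = (\<Union>w\<in>(\<lambda>x. F x i) -` B. cylinder (U i) w)"
      by (fastforce simp: cylinder_def)
    moreover have "open (\<Union>w\<in>(\<lambda>x. F x i) -` B. cylinder (U i) w)"
      using open_cylinder[OF assms(1)] by (intro open_UN ballI)
    ultimately show ?thesis by simp
  qed
  then show "continuous_on UNIV (\<lambda>x. F x i)" by (simp add: continuous_on_open_vimage)
qed

lemma compact_config: "compact (UNIV :: config set)"
proof -
  have "compactin (product_topology (\<lambda>_::nat. euclidean :: letter topology) UNIV) (Pi\<^sub>E UNIV (\<lambda>_. UNIV))"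
    unfolding compactin_PiE by (simp add: finite_imp_compact)
  then show ?thesis by (simp add: euclidean_product_topology PiE_UNIV_domain)
qed

lemma open_contains_cylinder:
  assumes "open S" "x \<in> S"
  obtains m where "cylinder {..<m} x \<subseteq> S"
proof -
  obtain X where X: "x \<in> Pi\<^sub>E UNIV X" "\<And>i. open (X i)" "finite {i. X i \<noteq> UNIV}" "Pi\<^sub>E UNIV X \<subseteq> S"
    using assms product_topology_open_contains_basis[of "\<lambda>_. euclidean" UNIV S x]
    by (auto simp: euclidean_product_topology)
  obtain m where m: "{i. X i \<noteq> UNIV} \<subseteq> {..<m}"
    using X(3) finite_nat_iff_bounded by blast
  have "cylinder {..<m} x \<subseteq> Pi\<^sub>E UNIV X"
    using X(1) m by (fastforce simp: cylinder_def PiE_UNIV_domain)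
  from this X(4) show thesis by (rule that[OF order.trans])
qed

text \<open>Uniform continuity from compactness: the space is covered by finitely many cylinders on
  which f stays within e/2 of its value at the centre, and points that agree up to the longest of
  their lengths share one of them.\<close>

lemma continuous_approx_depends_on:
  fixes f :: "config \<Rightarrow> real"
  assumes f: "continuous_on UNIV f" and "0 < e"
  obtains m where "\<And>x y. (\<And>i. i < m \<Longrightarrow> x i = y i) \<Longrightarrow> \<bar>f x - f y\<bar> < e"
proof -
  have "\<exists>m. cylinder {..<m} x \<subseteq> f -` ball (f x) (e/2)" for x
    using f \<open>0 < e\<close> by (metis open_contains_cylinder open_vimage open_ball centre_in_ball half_gt_zero vimageI)
  then obtain m where m: "\<And>x. cylinder {..<m x} x \<subseteq> f -` ball (f x) (e/2)"
    by metis
  have "UNIV \<subseteq> (\<Union>x\<in>UNIV. cylinder {..<m x} x)"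
    by (auto simp: cylinder_def)
  then obtain D where D: "finite D" "UNIV \<subseteq> (\<Union>x\<in>D. cylinder {..<m x} x)"
    by (rule compactE_image[OF compact_config open_cylinder[OF finite_lessThan]])
  show thesis
  proof (rule that[of "Max (insert 0 (m ` D))"])
    fix x y :: config assume xy: "\<And>i. i < Max (insert 0 (m ` D)) \<Longrightarrow> x i = y i"
    obtain d where d: "d \<in> D" "x \<in> cylinder {..<m d} d"
      using D(2) by blast
    then have "m d \<le> Max (insert 0 (m ` D))"
      using D(1) by (intro Max_ge) auto
    then have "y \<in> cylinder {..<m d} d"
      using d(2) xy by (force simp: cylinder_def)
    then have "\<bar>f d - f x\<bar> < e/2" "\<bar>f d - f y\<bar> < e/2"
      using m[of d] d(2) by (auto simp: subset_iff dist_real_def)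
    then show "\<bar>f x - f y\<bar> < e" by linarith
  qed
qed

text \<open>Cylinders control all functions of finitely many coordinates, and these approximate
  continuous functions uniformly.\<close>

lemma converges_weakly_cylinders:
  fixes M :: "nat \<Rightarrow> config measure"
  assumes M: "\<And>n. M n \<in> borel_probs" and N: "N \<in> borel_probs"
    and conv: "\<And>U w. finite U \<Longrightarrow> (\<lambda>n. measure (M n) (cylinder U w)) \<longlonglongrightarrow> measure N (cylinder U w)"
  shows "converges_weakly M N"
  unfolding converges_weakly_def
proof (intro allI impI)
  fix f :: "config \<Rightarrow> real" assume f: "continuous_on UNIV f" "bounded (range f)"
  have [measurable]: "f \<in> borel_measurable borel"
    using f(1) by (rule borel_measurable_continuous_onI)
  obtain B where B: "\<And>x. \<bar>f x\<bar> \<le> B"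
    using f(2) by (auto simp: bounded_iff)
  show "(\<lambda>n. \<integral>x. f x \<partial>M n) \<longlonglongrightarrow> (\<integral>x. f x \<partial>N)"
  proof (rule LIMSEQ_I)
    fix r :: real assume "0 < r"
    then obtain m where m: "\<And>x y. (\<And>i. i < m \<Longrightarrow> x i = y i) \<Longrightarrow> \<bar>f x - f y\<bar> < r/4"
      using continuous_approx_depends_on[OF f(1), of "r/4"] by auto
    \<comment> \<open>Coordinates from m on are overwritten by a fixed letter, which moves f by less
      than r/4. Two such errors and one of convergence stay below r.\<close>
    define g where "g x = f (\<lambda>i. if i < m then x i else undefined)" for x
    have g: "depends_on {..<m} g"
      by (auto simp: depends_on_def g_def intro!: arg_cong[of _ _ f])
    have close: "\<bar>(\<integral>x. f x \<partial>P) - (\<integral>x. g x \<partial>P)\<bar> \<le> r/4" if P: "P \<in> borel_probs" for P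
    proof -
      interpret prob_space P using borel_probsD[OF P] by simp
      have fP: "integrable P f"
        using borel_probsD(2)[OF P] by (intro integrable_const_bound[where B = B]) (auto simp: B cong: measurable_cong_sets)
      have gP: "integrable P g"
        by (rule integrable_depends_on[OF P _ g]) simp
      have "\<bar>f x - g x\<bar> \<le> r/4" for x
        unfolding g_def by (rule less_imp_le, rule m) simp
      then have "\<bar>\<integral>x. f x - g x \<partial>P\<bar> \<le> (\<integral>x. r/4 \<partial>P)"
        by (intro order.trans[OF integral_abs_bound] integral_mono) (use fP gP in auto)
      then show ?thesis using fP gP by (simp add: prob_space)
    qed
    have "(\<lambda>n. \<integral>x. g x \<partial>M n) \<longlonglongrightarrow> (\<integral>x. g x \<partial>N)"
      unfolding integral_depends_on[OF M finite_lessThan g] integral_depends_on[OF N finite_lessThan g]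
      by (intro tendsto_sum tendsto_mult_left conv) simp
    then obtain n0 where n0: "\<And>n. n \<ge> n0 \<Longrightarrow> \<bar>(\<integral>x. g x \<partial>M n) - (\<integral>x. g x \<partial>N)\<bar> < r/4"
      using LIMSEQ_D[of _ _ "r/4"] \<open>0 < r\<close> by (metis real_norm_def zero_less_divide_iff zero_less_numeral)
    have "norm ((\<integral>x. f x \<partial>M n) - (\<integral>x. f x \<partial>N)) < r" if "n \<ge> n0" for n
      using n0[OF that] close[OF M[of n]] close[OF N] \<open>0 < r\<close> unfolding real_norm_def by linarith
    then show "\<exists>n0. \<forall>n\<ge>n0. norm ((\<integral>x. f x \<partial>M n) - (\<integral>x. f x \<partial>N)) < r" by blast
  qed
qed

text \<open>The recursion expresses each term through the next one, so an exact solution is a limit of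
  solutions started further and further out; the limit exists by Tychonoff.\<close>
lemma backward_recursion_solvable:
  fixes g :: "nat \<Rightarrow> real \<Rightarrow> real" and lo hi :: "nat \<Rightarrow> real"
  assumes g: "\<And>k. continuous_on UNIV (g k)"
    and le: "\<And>k. lo k \<le> hi k"
    and maps: "\<And>k x. x \<in> {lo (Suc k)..hi (Suc k)} \<Longrightarrow> g k x \<in> {lo k..hi k}"
  obtains p where "\<And>k. p k \<in> {lo k..hi k}" "\<And>k. p k = g k (p (Suc k))"
proof -
  define B where "B = Pi\<^sub>E UNIV (\<lambda>k. {lo k..hi k})"
  define S where "S k = {p. p k = g k (p (Suc k))}" for k
  have "compactin (product_topology (\<lambda>_::nat. euclidean :: real topology) UNIV) B"
    unfolding B_def compactin_PiE by simp
  then have "compact B" by (simp add: euclidean_product_topology)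
  moreover have closed: "closed (S k)" for k
    unfolding S_def
    by (intro closed_Collect_eq continuous_on_product_coordinates continuous_on_compose2[OF g]) auto
  moreover have nonempty: "B \<inter> (\<Inter>k\<in>I. S k) \<noteq> {}" if I: "finite I" for I
  proof -
    obtain m where m: "I \<subseteq> {..<m}" using I finite_nat_iff_bounded by blast
    \<comment> \<open>After d rounds the equations with indices from m - d to m - 1 hold. Repairing
      index \<open>?j\<close> can spoil at most the equation just below it, whose turn comes
      next.\<close>
    have "\<exists>p. (\<forall>k. p k \<in> {lo k..hi k}) \<and> (\<forall>k<m. p k = g k (p (Suc k)) \<or> k < m - d)" for d
    proof (induction d)
      case 0
      show ?case using le by (intro exI[of _ lo]) auto
    next
      case (Suc d)
      then obtain p where p: "\<And>k. p k \<in> {lo k..hi k}" "\<And>k. k < m \<Longrightarrow> p k = g k (p (Suc k)) \<or> k < m - d"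
        by blast
      let ?j = "m - Suc d"
      show ?case
      proof (intro exI[of _ "p(?j := g ?j (p (Suc ?j)))"] conjI allI impI)
        fix k
        show "(p(?j := g ?j (p (Suc ?j)))) k \<in> {lo k..hi k}"
          using p(1) maps[of "p (Suc ?j)" ?j] by auto
        assume "k < m"
        then show "(p(?j := g ?j (p (Suc ?j)))) k = g k ((p(?j := g ?j (p (Suc ?j)))) (Suc k)) \<or> k < m - Suc d"
          using p(2)[of k] by (cases "k = ?j") auto
      qed
    qed
    from this[of m] obtain p where "p \<in> B" "\<forall>k<m. p \<in> S k"
      by (auto simp: B_def S_def PiE_UNIV_domain Pi_iff)
    then show ?thesis using m by blast
  qed
  ultimately have "B \<inter> (\<Inter>k\<in>UNIV. S k) \<noteq> {}"
    using compact_imp_fip_image[of B UNIV S] by blast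
  then obtain p where "p \<in> B" "\<forall>k. p \<in> S k" by auto
  then show thesis by (intro that[of p]) (unfold B_def S_def PiE_UNIV_domain Pi_iff mem_Collect_eq, blast+)
qed

section \<open>Single coordinates, and observables local at a level\<close>

lemma sum_letter: "(\<Sum>a\<in>UNIV. h a) = h (False, False) + h (False, True) + h (True, False) + h (True, True)"
  for h :: "letter \<Rightarrow> real"
proof -
  have "(UNIV :: letter set) = {(False, False), (False, True), (True, False), (True, True)}"
    by auto
  then have "sum h UNIV = sum h {(False, False), (False, True), (True, False), (True, True)}"
    by (rule arg_cong)
  then show ?thesis by (simp add: add.assoc)
qed

lemma product_law_integral_coordinate:
  fixes h :: "letter \<Rightarrow> real"
  assumes "product_law q M"
  shows "(\<integral>x. h (x i) \<partial>M) = (\<Sum>a\<in>UNIV. h a * q i a)"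
proof -
  note M = product_lawD(1)[OF assms]
  interpret prob_space M using borel_probsD[OF M] by simp
  have m: "cylinder {i} w \<in> sets M" for w
    using cylinder_borel[of "{i}"] borel_probsD[OF M] by simp
  have "(\<integral>x. h (x i) \<partial>M) = (\<integral>x. (\<Sum>a\<in>UNIV. h a * indicator (cylinder {i} (\<lambda>_. a)) x) \<partial>M)"
  proof (intro Bochner_Integration.integral_cong refl)
    fix x :: config
    have "(\<Sum>a\<in>UNIV. h a * indicator (cylinder {i} (\<lambda>_. a)) x) = (\<Sum>a\<in>UNIV. if a = x i then h a else 0)"
      by (intro sum.cong) (auto simp: cylinder_def indicator_def)
    then show "h (x i) = (\<Sum>a\<in>UNIV. h a * indicator (cylinder {i} (\<lambda>_. a)) x)" by simp
  qed
  also have "\<dots> = (\<Sum>a\<in>UNIV. \<integral>x. h a * indicator (cylinder {i} (\<lambda>_. a)) x \<partial>M)"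
    by (intro Bochner_Integration.integral_sum integrable_mult_right integrable_real_indicator m)
      (simp add: emeasure_eq_measure)
  also have "\<dots> = (\<Sum>a\<in>UNIV. h a * q i a)"
    using m product_lawD(2)[OF assms, of "{i}"] by (simp add: Int_absorb1 sets.sets_into_space)
  finally show ?thesis .
qed

lemma bounded_depends_on:
  fixes f :: "config \<Rightarrow> real"
  assumes "finite U" "depends_on U f"
  obtains B where "\<And>x. \<bar>f x\<bar> \<le> B"
proof
  fix x
  have "f x = f (restrict x U)"
    by (rule depends_onD[OF assms(2)]) simp
  also have "\<bar>\<dots>\<bar> \<le> Max ((\<lambda>w. \<bar>f w\<bar>) ` Pi\<^sub>E U (\<lambda>_. UNIV))"
    using finite_words[OF assms(1)] by (intro Max_ge) auto
  finally show "\<bar>f x\<bar> \<le> Max ((\<lambda>w. \<bar>f w\<bar>) ` Pi\<^sub>E U (\<lambda>_. UNIV))" .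
qed

text \<open>The cells of level l are \<open>prod_encode (l, i)\<close> for all i. The number l will
  in turn encode a pair, from \<open>up\<close> on.\<close>

definition level :: "nat \<Rightarrow> nat" where
  "level c = fst (prod_decode c)"

definition local_at :: "nat \<Rightarrow> (config \<Rightarrow> 'a) \<Rightarrow> bool" where
  "local_at l f \<longleftrightarrow> (\<exists>U. finite U \<and> U \<subseteq> level -` {l} \<and> depends_on U f)"

lemma local_at_comp: "local_at l f \<Longrightarrow> local_at l (\<lambda>x. g (f x))"
  unfolding local_at_def using depends_on_comp[of _ f g] by auto

text \<open>Distinct levels have disjoint cells. Levels are attached to indices by an injective
  labelling t because each step of the dynamics will relabel l as \<open>s l\<close>.\<close>

lemma local_family_supports:
  assumes "\<And>j. j \<in> S \<Longrightarrow> local_at (t j) (f j)" "inj_on t S"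
  obtains U where "\<And>j. j \<in> S \<Longrightarrow> finite (U j)" "\<And>j. j \<in> S \<Longrightarrow> U j \<subseteq> level -` {t j}"
    "\<And>j. j \<in> S \<Longrightarrow> depends_on (U j) (f j)" "disjoint_family_on U S"
proof -
  have "\<forall>j\<in>S. \<exists>U. finite U \<and> U \<subseteq> level -` {t j} \<and> depends_on U (f j)"
    using assms(1) by (simp add: local_at_def)
  then obtain U where U: "\<forall>j\<in>S. finite (U j) \<and> U j \<subseteq> level -` {t j} \<and> depends_on (U j) (f j)"
    by (rule bchoice[THEN exE])
  show thesis
  proof (rule that[of U])
    show "disjoint_family_on U S"
      unfolding disjoint_family_on_def
    proof (intro ballI impI)
      fix i j assume ij: "i \<in> S" "j \<in> S" "i \<noteq> j"
      then have "U i \<subseteq> level -` {t i}" "U j \<subseteq> level -` {t j}" "t i \<noteq> t j"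
        using U assms(2) by (auto dest: inj_onD)
      then show "U i \<inter> U j = {}" by fastforce
    qed
  qed (use U in auto)
qed

text \<open>Splitting a cylinder by levels turns its measure into the mean of a product of local
  functions at distinct levels, a form preserved by the dual dynamics.\<close>

lemma indicator_cylinder_levels:
  assumes "finite U"
  shows "indicator (cylinder U w) x
    = (\<Prod>l\<in>level ` U. indicator (cylinder (U \<inter> level -` {l}) w) x :: real)"
proof (cases "x \<in> cylinder U w")
  case True
  then show ?thesis by (simp add: cylinder_def indicator_def)
next
  case False
  then obtain i where "i \<in> U" "x i \<noteq> w i" by (auto simp: cylinder_def)
  then have "\<exists>l\<in>level ` U. indicator (cylinder (U \<inter> level -` {l}) w) x = (0::real)"
    by (auto simp: cylinder_def indicator_def)
  then show ?thesis using False assms by (simp add: prod_zero_iff)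
qed

lemma local_at_indicator_cylinder:
  "finite U \<Longrightarrow> local_at l (indicator (cylinder (U \<inter> level -` {l}) w))"
  unfolding local_at_def by (intro exI[of _ "U \<inter> level -` {l}"]) (simp add: depends_on_indicator_cylinder)

section \<open>Chains of levels, each copying the signal of the next\<close>

locale signal_chain =
  fixes \<epsilon> :: real and s :: "nat \<Rightarrow> nat" and v :: "nat \<Rightarrow> config \<Rightarrow> bool"
  assumes \<epsilon>: "0 \<le> \<epsilon>" "\<epsilon> \<le> 1"
    and inj_s: "inj s"
    and local_v: "local_at l (v l)"
begin

text \<open>The constant first component makes the noise visible: after a perturbed step it is true
  with probability \<epsilon>/2, independently at all cells and whatever x was.\<close>

definition F :: "config \<Rightarrow> config" where
  "F x c = (False, v (s (level c)) x)"

abbreviation K :: "config \<Rightarrow> config measure" where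
  "K \<equiv> perturbation F \<epsilon>"

definition weight :: "letter \<Rightarrow> letter \<Rightarrow> real" where
  "weight a b = (1 - \<epsilon>) * of_bool (b = a) + \<epsilon> / real CARD(letter)"

text \<open>The configuration \<open>undefined\<close> is irrelevant, since the perturbed map is constant.\<close>
definition block_law :: "bool \<Rightarrow> config measure" where
  "block_law b = perturbation (\<lambda>_ _. (False, b)) \<epsilon> undefined"

definition ev :: "bool \<Rightarrow> (config \<Rightarrow> real) \<Rightarrow> real" where
  "ev b f = (\<integral>x. f x \<partial>block_law b)"

lemma product_law_perturbation:
  assumes "continuous_on UNIV F'"
  shows "perturbation F' \<epsilon> \<in> borel \<rightarrow>\<^sub>M prob_algebra borel"
    and "product_law (\<lambda>i. weight (F' x i)) (perturbation F' \<epsilon> x)"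
proof -
  have *: "is_computer_perturbation F' \<epsilon> (perturbation F' \<epsilon>)"
    by (rule is_computer_perturbation_perturbation[OF assms \<epsilon>])
  then show m: "perturbation F' \<epsilon> \<in> borel \<rightarrow>\<^sub>M prob_algebra borel"
    by (simp add: is_computer_perturbation_def)
  show "product_law (\<lambda>i. weight (F' x i)) (perturbation F' \<epsilon> x)"
    using * measurable_space[OF m, of x]
    unfolding is_computer_perturbation_def product_law_def weight_def by simp
qed

lemma product_law_block_law: "product_law (\<lambda>_. weight (False, b)) (block_law b)"
  unfolding block_law_def by (rule product_law_perturbation(2)) simp

text \<open>At this x the map is constant on each level, so on the support of each factor the
  marginals are those of a block law; disjoint supports make the integral factor.\<close>

lemma integral_perturbation_prod:
  fixes f :: "'i \<Rightarrow> config \<Rightarrow> real"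
  assumes F': "continuous_on UNIV F'" "\<And>c. F' x c = (False, u (level c))"
    and S: "finite S" and inj: "inj_on t S" and f: "\<And>j. j \<in> S \<Longrightarrow> local_at (t j) (f j)"
  shows "(\<integral>y. (\<Prod>j\<in>S. f j y) \<partial>perturbation F' \<epsilon> x) = (\<Prod>j\<in>S. ev (u (t j)) (f j))"
proof -
  obtain U where U: "\<And>j. j \<in> S \<Longrightarrow> finite (U j)" "\<And>j. j \<in> S \<Longrightarrow> U j \<subseteq> level -` {t j}"
    "\<And>j. j \<in> S \<Longrightarrow> depends_on (U j) (f j)" "disjoint_family_on U S"
    using local_family_supports[OF f inj] by blast
  note P = product_law_perturbation(2)[OF F'(1), of x]
  have "(\<integral>y. f j y \<partial>perturbation F' \<epsilon> x) = ev (u (t j)) (f j)" if "j \<in> S" for j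
    unfolding ev_def
    by (rule product_law_integral_cong[OF P product_law_block_law U(1)[OF that] U(3)[OF that]])
      (use U(2)[OF that] in \<open>auto simp: F'(2)\<close>)
  then show ?thesis
    using product_law_integral_prod[OF P S U(1) U(3,4)] by simp
qed

text \<open>Integrate \<open>integral_perturbation_prod\<close> over x. The map is kept general
  because the lemma serves both \<open>F\<close> and the map \<open>H\<close> that builds mixture
  laws.\<close>

lemma integral_kernel_action_prod:
  fixes f :: "'i \<Rightarrow> config \<Rightarrow> real"
  assumes F': "continuous_on UNIV F'" "\<And>x c. F' x c = (False, u (level c) x)"
    and \<mu>: "\<mu> \<in> borel_probs"
    and S: "finite S" and inj: "inj_on t S" and f: "\<And>j. j \<in> S \<Longrightarrow> local_at (t j) (f j)"
  shows "(\<integral>y. (\<Prod>j\<in>S. f j y) \<partial>kernel_action (perturbation F' \<epsilon>) \<mu>)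
    = (\<integral>x. (\<Prod>j\<in>S. ev (u (t j) x) (f j)) \<partial>\<mu>)"
proof -
  obtain U where U: "\<And>j. j \<in> S \<Longrightarrow> finite (U j)" "\<And>j. j \<in> S \<Longrightarrow> depends_on (U j) (f j)"
    using local_family_supports[OF f inj] by metis
  have fin: "finite (\<Union>j\<in>S. U j)" using S U(1) by blast
  have dep: "depends_on (\<Union>j\<in>S. U j) (\<lambda>y. \<Prod>j\<in>S. f j y)"
    by (intro depends_on_prod U(2))
  obtain B where B: "\<And>y. \<bar>\<Prod>j\<in>S. f j y\<bar> \<le> B"
    using bounded_depends_on[OF fin dep] by blast
  have "(\<integral>y. (\<Prod>j\<in>S. f j y) \<partial>perturbation F' \<epsilon> x) = (\<Prod>j\<in>S. ev (u (t j) x) (f j))" for x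
    by (rule integral_perturbation_prod[where u = "\<lambda>l. u l x"]) (use F' S inj f in auto)
  then show ?thesis
    using integral_kernel_action[OF \<mu> product_law_perturbation(1)[OF F'(1)] borel_measurable_depends_on[OF fin dep] B]
    by simp
qed

lemma continuous_F: "continuous_on UNIV F"
proof -
  have "\<exists>U. finite U \<and> depends_on U (\<lambda>x. F x c)" for c
    using local_at_comp[OF local_v[of "s (level c)"], of "Pair False"] unfolding local_at_def F_def by blast
  then obtain U where "\<And>c. finite (U c)" "\<And>c. depends_on (U c) (\<lambda>x. F x c)"
    by metis
  then show ?thesis by (rule continuous_on_depends_on)
qed

lemmas measurable_K = product_law_perturbation(1)[OF continuous_F]

text \<open>One step of the dual dynamics on observables: a function local at level \<open>l\<close> becomes a function
  of the signal of level \<open>s l\<close> alone.\<close>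
definition pull :: "nat \<Rightarrow> (config \<Rightarrow> real) \<Rightarrow> config \<Rightarrow> real" where
  "pull l f x = ev (v (s l) x) f"

primrec pull_iter :: "nat \<Rightarrow> nat \<Rightarrow> (config \<Rightarrow> real) \<Rightarrow> config \<Rightarrow> real" where
  "pull_iter 0 l f = f"
| "pull_iter (Suc n) l f = pull_iter n (s l) (pull l f)"

lemma local_at_pull: "local_at (s l) (pull l f)"
  unfolding pull_def by (rule local_at_comp[OF local_v])

lemma integral_step:
  assumes "\<mu> \<in> borel_probs" "finite S" "inj_on t S" "\<And>j. j \<in> S \<Longrightarrow> local_at (t j) (f j)"
  shows "(\<integral>y. (\<Prod>j\<in>S. f j y) \<partial>kernel_action K \<mu>) = (\<integral>x. (\<Prod>j\<in>S. pull (t j) (f j) x) \<partial>\<mu>)"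
  unfolding pull_def using assms
  by (intro integral_kernel_action_prod[where u = "\<lambda>l. v (s l)"] continuous_F) (auto simp: F_def)

lemma iterate_borel_probs:
  "\<mu> \<in> borel_probs \<Longrightarrow> (kernel_action K ^^ n) \<mu> \<in> borel_probs"
  by (induction n) (auto intro: kernel_action_borel_probs measurable_K)

text \<open>Each step moves the factor at level l to level \<open>s l\<close>. Since
  \<open>s\<close> is injective, the factors stay at distinct levels and the induction
  continues.\<close>

lemma integral_iterate:
  assumes "\<mu> \<in> borel_probs" "finite S" "inj_on t S" "\<And>j. j \<in> S \<Longrightarrow> local_at (t j) (f j)"
  shows "(\<integral>y. (\<Prod>j\<in>S. f j y) \<partial>(kernel_action K ^^ n) \<mu>) = (\<integral>x. (\<Prod>j\<in>S. pull_iter n (t j) (f j) x) \<partial>\<mu>)"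
  using assms(3,4)
proof (induction n arbitrary: t f)
  case (Suc n)
  have inj: "inj_on (\<lambda>j. s (t j)) S"
    using Suc.prems(1) inj_s by (auto simp: inj_on_def)
  have "(\<integral>y. (\<Prod>j\<in>S. f j y) \<partial>(kernel_action K ^^ Suc n) \<mu>)
      = (\<integral>x. (\<Prod>j\<in>S. pull (t j) (f j) x) \<partial>(kernel_action K ^^ n) \<mu>)"
    using integral_step[OF iterate_borel_probs[OF assms(1)] assms(2) Suc.prems] by simp
  also have "\<dots> = (\<integral>x. (\<Prod>j\<in>S. pull_iter n (s (t j)) (pull (t j) (f j)) x) \<partial>\<mu>)"
    by (rule Suc.IH[OF inj local_at_pull])
  finally show ?case by simp
qed simp

section \<open>Equilibria and the invariant measures they define\<close>

text \<open>The probability that level l emits a true bit after being fed b. The two values form the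
  transition matrix of a two-state chain.\<close>

definition act :: "bool \<Rightarrow> nat \<Rightarrow> real" where
  "act b l = ev b (\<lambda>x. of_bool (v l x))"

text \<open>The mean of f when the bit fed to its level is random and true with probability r,
  written as an affine function of r.\<close>

definition mix :: "real \<Rightarrow> (config \<Rightarrow> real) \<Rightarrow> real" where
  "mix r f = ev False f + r * (ev True f - ev False f)"

lemma mix_of_bool: "ev b f = mix (of_bool b) f"
  by (cases b) (simp_all add: mix_def)

lemma integrable_of_bool:
  assumes "M \<in> borel_probs" shows "integrable M (\<lambda>x. of_bool (v l x) :: real)"
proof -
  obtain U where "finite U" "depends_on U (v l)"
    using local_v[of l] by (auto simp: local_at_def)
  then show ?thesis by (rule integrable_depends_on[OF assms _ depends_on_comp])
qed

text \<open>The function \<open>pull l f\<close> takes only the values \<open>ev False f\<close> and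
  \<open>ev True f\<close>, so its mean depends only on how likely the signal is to be true.\<close>

lemma ev_pull: "ev b (pull l f) = mix (act b (s l)) f"
proof -
  note M = product_lawD(1)[OF product_law_block_law[of b]]
  interpret prob_space "block_law b" using borel_probsD[OF M] by simp
  have "pull l f = (\<lambda>x. ev False f + of_bool (v (s l) x) * (ev True f - ev False f))"
    by (auto simp: pull_def fun_eq_iff)
  then show ?thesis
    unfolding act_def ev_def[of b] mix_def
    using integrable_of_bool[OF M] by (simp add: prob_space)
qed

lemma act_bounds: "0 \<le> act b l" "act b l \<le> 1"
proof -
  note M = product_lawD(1)[OF product_law_block_law[of b]]
  interpret prob_space "block_law b" using borel_probsD[OF M] by simp
  show "0 \<le> act b l" unfolding act_def ev_def by (rule integral_nonneg_AE) simp
  have "act b l \<le> (\<integral>x. 1 \<partial>block_law b)"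
    unfolding act_def ev_def using integrable_of_bool[OF M] by (intro integral_mono) auto
  then show "act b l \<le> 1" by (simp add: prob_space)
qed

text \<open>Here \<open>p l\<close> is the probability that the bit copied by level l is true; this
  bit is emitted by level \<open>s l\<close>, itself fed a true bit with probability
  \<open>p (s l)\<close>.\<close>

definition equilibrium :: "(nat \<Rightarrow> real) \<Rightarrow> bool" where
  "equilibrium p \<longleftrightarrow> (\<forall>l. 0 \<le> p l \<and> p l \<le> 1 \<and>
     p l = act False (s l) + p (s l) * (act True (s l) - act False (s l)))"

text \<open>Both sides are affine in the probability of the copied bit, and the equilibrium equation
  identifies these probabilities.\<close>

lemma mix_pull:
  assumes "equilibrium p"
  shows "mix (p (s l)) (pull l f) = mix (p l) f"
proof -
  have "p l = act False (s l) + p (s l) * (act True (s l) - act False (s l))"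
    using assms unfolding equilibrium_def by blast
  then have "mix (p l) f = ev False f
      + (act False (s l) + p (s l) * (act True (s l) - act False (s l))) * (ev True f - ev False f)"
    by (simp only: mix_def)
  then show ?thesis
    unfolding mix_def[of "p (s l)"] ev_pull by (simp add: mix_def algebra_simps)
qed

text \<open>The levels are independent, and level l is a mixture of the two block laws with weight
  \<open>p l\<close> on the true one.\<close>

definition mixture_law :: "(nat \<Rightarrow> real) \<Rightarrow> config measure \<Rightarrow> bool" where
  "mixture_law p \<pi> \<longleftrightarrow> \<pi> \<in> borel_probs \<and>
     (\<forall>S f. finite S \<longrightarrow> (\<forall>l\<in>S. local_at l (f l)) \<longrightarrow>
        (\<integral>x. (\<Prod>l\<in>S. f l x) \<partial>\<pi>) = (\<Prod>l\<in>S. mix (p l) (f l)))"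

lemma mixture_law_integral:
  fixes f :: "nat \<Rightarrow> config \<Rightarrow> real"
  assumes "mixture_law p \<pi>" "finite S" "inj_on t S" "\<And>j. j \<in> S \<Longrightarrow> local_at (t j) (f j)"
  shows "(\<integral>x. (\<Prod>j\<in>S. f j x) \<partial>\<pi>) = (\<Prod>j\<in>S. mix (p (t j)) (f j))"
proof -
  have inv: "the_inv_into S t (t j) = j" if "j \<in> S" for j
    using that assms(3) by (simp add: the_inv_into_f_f)
  have loc: "\<forall>l\<in>t ` S. local_at l (f (the_inv_into S t l))"
    using assms(4) by (simp add: inv)
  have "(\<integral>x. (\<Prod>l\<in>t ` S. f (the_inv_into S t l) x) \<partial>\<pi>) = (\<Prod>l\<in>t ` S. mix (p l) (f (the_inv_into S t l)))"
    using assms(1)[unfolded mixture_law_def, THEN conjunct2, rule_format, of "t ` S" "\<lambda>l. f (the_inv_into S t l)"]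
      assms(2) loc by blast
  then show ?thesis
    using assms(3) inv by (simp add: prod.reindex)
qed

text \<open>Draw one independent bit per level, then let a perturbed map copy the bit of each level
  to all of its cells.\<close>

lemma mixture_law_exists:
  assumes p: "\<And>l. 0 \<le> p l \<and> p l \<le> 1"
  obtains \<pi> where "mixture_law p \<pi>"
proof -
  \<comment> \<open>Coordinate l of the auxiliary configuration carries the bit of level l in its
    second component.\<close>
  define r where "r l = map_pmf (Pair False) (bernoulli_pmf (p l))" for l
  define Q where "Q = PiM UNIV (\<lambda>l::nat. measure_pmf (r l))"
  define H where "H x c = (False, snd (x (level c)))" for x :: config and c
  have Q: "product_law (\<lambda>l. pmf (r l)) Q"
    unfolding Q_def by (rule product_law_exists)
  note QB = product_lawD(1)[OF Q]
  interpret prob_space Q using borel_probsD[OF QB] by simp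
  have H: "continuous_on UNIV H"
    by (rule continuous_on_depends_on[where U = "\<lambda>c. {level c}"]) (auto simp: H_def depends_on_def)
  have r: "pmf (r l) (False, True) = p l" "pmf (r l) (True, True) = 0" for l
  proof -
    show "pmf (r l) (False, True) = p l"
      unfolding r_def using p[of l] by (subst pmf_map_inj') (auto simp: inj_def)
    show "pmf (r l) (True, True) = 0"
      unfolding r_def by (rule pmf_map_outside) auto
  qed
  have coord: "(\<integral>x. ev (snd (x l)) f \<partial>Q) = mix (p l) f" for l f
  proof -
    have "(\<integral>x. of_bool (snd (x l)) \<partial>Q) = p l"
      unfolding product_law_integral_coordinate[OF Q, of "\<lambda>a. of_bool (snd a)"] sum_letter by (simp add: r)
    moreover have "integrable Q (\<lambda>x. of_bool (snd (x l)) :: real)"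
      by (rule integrable_depends_on[OF QB, of "{l}"]) (auto simp: depends_on_def)
    moreover have eq: "(\<lambda>x. ev (snd (x l)) f) = (\<lambda>x. ev False f + of_bool (snd (x l)) * (ev True f - ev False f))"
      by (auto simp: fun_eq_iff)
    ultimately show ?thesis
      unfolding eq mix_def by (simp add: prob_space)
  qed
  have "mixture_law p (kernel_action (perturbation H \<epsilon>) Q)"
    unfolding mixture_law_def
  proof (intro conjI allI impI)
    show "kernel_action (perturbation H \<epsilon>) Q \<in> borel_probs"
      by (rule kernel_action_borel_probs[OF QB product_law_perturbation(1)[OF H]])
    fix S :: "nat set" and f :: "nat \<Rightarrow> config \<Rightarrow> real"
    assume S: "finite S" and f: "\<forall>l\<in>S. local_at l (f l)"
    have "(\<integral>x. (\<Prod>l\<in>S. f l x) \<partial>kernel_action (perturbation H \<epsilon>) Q) = (\<integral>x. (\<Prod>l\<in>S. ev (snd (x l)) (f l)) \<partial>Q)"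
      by (rule integral_kernel_action_prod[where u = "\<lambda>l x. snd (x l)" and t = "\<lambda>l. l"])
        (use H QB S f in \<open>auto simp: H_def\<close>)
    also have "\<dots> = (\<Prod>l\<in>S. \<integral>x. ev (snd (x l)) (f l) \<partial>Q)"
      by (rule product_law_integral_prod[OF Q S, where U = "\<lambda>l. {l}"])
        (auto simp: depends_on_def disjoint_family_on_def)
    finally show "(\<integral>x. (\<Prod>l\<in>S. f l x) \<partial>kernel_action (perturbation H \<epsilon>) Q) = (\<Prod>l\<in>S. mix (p l) (f l))"
      by (simp add: coord)
  qed
  then show thesis by (rule that)
qed

lemma measure_cylinder_eq_integral:
  assumes "\<mu> \<in> borel_probs" "finite U"
  shows "measure \<mu> (cylinder U w) = (\<integral>x. (\<Prod>l\<in>level ` U. indicator (cylinder (U \<inter> level -` {l}) w) x) \<partial>\<mu>)"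
  unfolding indicator_cylinder_levels[OF assms(2), symmetric]
  using cylinder_borel[OF assms(2)] borel_probsD[OF assms(1)] by simp

text \<open>Tested on a cylinder, one step moves each factor from l to \<open>s l\<close>, and
  \<open>mix_pull\<close> says that its mean does not change.\<close>

lemma mixture_law_invariant:
  assumes p: "equilibrium p" and \<pi>: "mixture_law p \<pi>"
  shows "\<pi> \<in> invariant_probs K"
proof -
  have \<pi>B: "\<pi> \<in> borel_probs" using \<pi> by (simp add: mixture_law_def)
  have K\<pi>: "kernel_action K \<pi> \<in> borel_probs"
    by (rule kernel_action_borel_probs[OF \<pi>B measurable_K])
  have "kernel_action K \<pi> = \<pi>"
  proof (rule config_measure_eqI[OF K\<pi> \<pi>B])
    fix U :: "nat set" and w :: config assume U: "finite U"
    let ?f = "\<lambda>l. indicator (cylinder (U \<inter> level -` {l}) w) :: config \<Rightarrow> real"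
    have "measure (kernel_action K \<pi>) (cylinder U w) = (\<integral>x. (\<Prod>l\<in>level ` U. pull l (?f l) x) \<partial>\<pi>)"
      unfolding measure_cylinder_eq_integral[OF K\<pi> U]
      by (rule integral_step[where t = "\<lambda>l. l", OF \<pi>B]) (auto simp: U local_at_indicator_cylinder)
    also have "\<dots> = (\<Prod>l\<in>level ` U. mix (p (s l)) (pull l (?f l)))"
      using inj_s by (intro mixture_law_integral[OF \<pi>]) (auto simp: U local_at_pull inj_on_def)
    also have "\<dots> = (\<Prod>l\<in>level ` U. mix (p l) (?f l))"
      by (simp add: mix_pull[OF p])
    also have "\<dots> = measure \<pi> (cylinder U w)"
      unfolding measure_cylinder_eq_integral[OF \<pi>B U]
      by (rule mixture_law_integral[OF \<pi>, where t = "\<lambda>l. l", symmetric]) (auto simp: U local_at_indicator_cylinder)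
    finally show "measure (kernel_action K \<pi>) (cylinder U w) = measure \<pi> (cylinder U w)" .
  qed
  then show ?thesis using \<pi>B by (simp add: invariant_probs_def)
qed

text \<open>The mean of the signal of level \<open>s l\<close> under \<pi> is the right-hand side of
  the equilibrium equation at l. Hence distinct equilibria have distinct mixture laws.\<close>

lemma equilibrium_recover:
  assumes p: "equilibrium p" and \<pi>: "mixture_law p \<pi>"
  shows "p l = (\<integral>x. of_bool (v (s l) x) \<partial>\<pi>)"
proof -
  \<comment> \<open>A product over one index, to fit the form of
    \<open>mixture_law_integral\<close>.\<close>
  have "(\<integral>x. (\<Prod>j\<in>{0::nat}. of_bool (v (s l) x)) \<partial>\<pi>) = (\<Prod>j\<in>{0::nat}. mix (p (s l)) (\<lambda>x. of_bool (v (s l) x)))"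
    by (rule mixture_law_integral[OF \<pi>]) (auto intro: local_at_comp[OF local_v])
  then have "(\<integral>x. of_bool (v (s l) x) \<partial>\<pi>) = act False (s l) + p (s l) * (act True (s l) - act False (s l))"
    by (simp add: mix_def act_def)
  moreover have "p l = act False (s l) + p (s l) * (act True (s l) - act False (s l))"
    using p unfolding equilibrium_def by blast
  ultimately show ?thesis by (rule trans[OF _ sym, rotated])
qed

lemma several_invariant_probs:
  assumes "equilibrium p" "equilibrium q" "p \<noteq> q"
  shows "\<exists>\<mu> \<nu>. \<mu> \<in> invariant_probs K \<and> \<nu> \<in> invariant_probs K \<and> \<mu> \<noteq> \<nu>"
proof -
  obtain \<mu> where \<mu>: "mixture_law p \<mu>"
    using mixture_law_exists assms(1) unfolding equilibrium_def by blast
  obtain \<nu> where \<nu>: "mixture_law q \<nu>"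
    using mixture_law_exists assms(2) unfolding equilibrium_def by blast
  have "\<mu> \<noteq> \<nu>"
    using equilibrium_recover[OF assms(1) \<mu>] equilibrium_recover[OF assms(2) \<nu>] assms(3)
    by (auto simp: fun_eq_iff)
  then show ?thesis
    using mixture_law_invariant[OF assms(1) \<mu>] mixture_law_invariant[OF assms(2) \<nu>] by blast
qed

section \<open>Contraction and ergodicity\<close>

text \<open>The Dobrushin contraction coefficient of the two-state transition
  \<open>act\<close>.\<close>

definition sensitivity :: "nat \<Rightarrow> real" where
  "sensitivity l = \<bar>act True l - act False l\<bar>"

text \<open>The first pull turns f into a function of one bit; each later pull multiplies the gap
  between its two values by \<open>act True - act False\<close> at the level reached.\<close>

lemma pull_iter_close:
  assumes p: "equilibrium p"
  shows "\<bar>pull_iter (Suc n) l f x - mix (p l) f\<bar>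
    \<le> \<bar>ev True f - ev False f\<bar> * (\<Prod>i<n. sensitivity ((s ^^ Suc i) l))"
proof (induction n arbitrary: l f)
  case 0
  have "0 \<le> p l" "p l \<le> 1" using p unfolding equilibrium_def by blast+
  moreover have "pull_iter (Suc 0) l f x - mix (p l) f = (of_bool (v (s l) x) - p l) * (ev True f - ev False f)"
    by (simp add: pull_def mix_of_bool[of "v (s l) x"] mix_def algebra_simps)
  ultimately show ?case
    by (auto simp: abs_mult intro!: mult_left_le_one_le)
next
  case (Suc n)
  have "\<bar>pull_iter (Suc (Suc n)) l f x - mix (p l) f\<bar> = \<bar>pull_iter (Suc n) (s l) (pull l f) x - mix (p (s l)) (pull l f)\<bar>"
    unfolding mix_pull[OF p] by simp
  also have "\<dots> \<le> \<bar>ev True (pull l f) - ev False (pull l f)\<bar> * (\<Prod>i<n. sensitivity ((s ^^ Suc i) (s l)))"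
    by (rule Suc.IH)
  also have "ev True (pull l f) - ev False (pull l f) = (act True (s l) - act False (s l)) * (ev True f - ev False f)"
    by (simp add: ev_pull mix_def algebra_simps)
  also have "\<bar>\<dots>\<bar> * (\<Prod>i<n. sensitivity ((s ^^ Suc i) (s l)))
      = \<bar>ev True f - ev False f\<bar> * (\<Prod>i<Suc n. sensitivity ((s ^^ Suc i) l))"
    unfolding prod.lessThan_Suc_shift
    by (simp add: sensitivity_def abs_mult funpow_swap1 del: prod.lessThan_Suc)
  finally show ?case .
qed

text \<open>The first k factors are only bounded by 1; truncated subtraction covers the case of
  fewer than k factors.\<close>

lemma prod_sensitivity_le:
  assumes "\<And>i. k \<le> i \<Longrightarrow> sensitivity ((s ^^ Suc i) l) \<le> 1/2"
  shows "(\<Prod>i<n. sensitivity ((s ^^ Suc i) l)) \<le> (1/2) ^ (n - k)"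
proof (induction n)
  case (Suc n)
  have le1: "0 \<le> sensitivity j" "sensitivity j \<le> 1" for j
    using act_bounds[of True j] act_bounds[of False j] by (auto simp: sensitivity_def)
  show ?case
  proof (cases "k \<le> n")
    case True
    have "(\<Prod>i<n. sensitivity ((s ^^ Suc i) l)) * sensitivity ((s ^^ Suc n) l) \<le> (1/2) ^ (n - k) * (1/2)"
      by (intro mult_mono Suc.IH assms True le1) simp
    then show ?thesis using True by (simp add: Suc_diff_le mult.commute)
  next
    case False
    have "(\<Prod>i<Suc n. sensitivity ((s ^^ Suc i) l)) \<le> 1"
      by (rule prod_le_1) (auto simp: le1)
    then show ?thesis using False by simp
  qed
qed simp

lemma pull_iter_tendsto:
  assumes p: "equilibrium p" and k: "\<And>i. k \<le> i \<Longrightarrow> sensitivity ((s ^^ Suc i) l) \<le> 1/2"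
  shows "(\<lambda>n. pull_iter (Suc n) l f x) \<longlonglongrightarrow> mix (p l) f"
proof (rule LIM_zero_cancel, rule Lim_null_comparison)
  have "\<bar>pull_iter (Suc n) l f x - mix (p l) f\<bar> \<le> \<bar>ev True f - ev False f\<bar> * (1/2) ^ (n - k)" for n
    by (rule order.trans[OF pull_iter_close[OF p]])
      (intro mult_left_mono prod_sensitivity_le k abs_ge_zero)
  then show "\<forall>\<^sub>F n in sequentially. norm (pull_iter (Suc n) l f x - mix (p l) f)
      \<le> \<bar>ev True f - ev False f\<bar> * (1/2) ^ (n - k)"
    by (simp del: pull_iter.simps)
  have "(\<lambda>n. (1/2::real) ^ (n - k)) \<longlonglongrightarrow> 0"
    by (rule LIMSEQ_offset[where k = k]) (simp add: LIMSEQ_power_zero)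
  then show "(\<lambda>n. \<bar>ev True f - ev False f\<bar> * (1/2) ^ (n - k)) \<longlonglongrightarrow> 0"
    by (rule tendsto_mult_right_zero)
qed

lemma pull_iter_bound:
  assumes p: "equilibrium p"
  shows "\<bar>pull_iter (Suc n) l f x\<bar> \<le> \<bar>mix (p l) f\<bar> + \<bar>ev True f - ev False f\<bar>"
proof -
  have "sensitivity j \<le> 1" "0 \<le> sensitivity j" for j
    using act_bounds[of True j] act_bounds[of False j] by (auto simp: sensitivity_def)
  then have "(\<Prod>i<n. sensitivity ((s ^^ Suc i) l)) \<le> 1"
    by (intro prod_le_1) auto
  then have "\<bar>ev True f - ev False f\<bar> * (\<Prod>i<n. sensitivity ((s ^^ Suc i) l)) \<le> \<bar>ev True f - ev False f\<bar>"
    by (intro mult_left_le) auto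
  then show ?thesis using pull_iter_close[OF p, of n l f x] by linarith
qed

text \<open>The measure of a cylinder at time n is the initial mean of a product of iterated pulls.
  These tend to constants that do not involve the initial law, so dominated convergence applies. An
  invariant law is its own limit and thus equals \<pi>.\<close>

lemma ergodic_if_insensitive:
  assumes p: "equilibrium p" and ins: "\<And>l. \<exists>k. \<forall>i\<ge>k. sensitivity ((s ^^ Suc i) l) \<le> 1/2"
  shows "ergodic K"
proof -
  obtain \<pi> where \<pi>: "mixture_law p \<pi>"
    using mixture_law_exists p unfolding equilibrium_def by blast
  have \<pi>B: "\<pi> \<in> borel_probs" using \<pi> by (simp add: mixture_law_def)
  have conv: "(\<lambda>n. measure ((kernel_action K ^^ n) \<mu>) (cylinder U w)) \<longlonglongrightarrow> measure \<pi> (cylinder U w)"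
    if \<mu>: "\<mu> \<in> borel_probs" and U: "finite U" for \<mu> U w
  proof -
    interpret prob_space \<mu> using borel_probsD[OF \<mu>] by simp
    let ?f = "\<lambda>l. indicator (cylinder (U \<inter> level -` {l}) w) :: config \<Rightarrow> real"
    have local: "local_at ((s ^^ n) l) (pull_iter n l (?f l))" for n l
    proof -
      have "local_at ((s ^^ n) l) (pull_iter n l g)" if "local_at l g" for g
        using that
      proof (induction n arbitrary: l g)
        case (Suc n)
        show ?case using Suc.IH[OF local_at_pull] by (simp add: funpow_swap1)
      qed simp
      then show ?thesis by (simp add: local_at_indicator_cylinder U)
    qed
    have meas: "pull_iter n l (?f l) \<in> borel_measurable \<mu>" for n l
      using local[of n l] borel_measurable_depends_on borel_probsD(2)[OF \<mu>]
      by (auto simp: local_at_def cong: measurable_cong_sets)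
    have it: "measure ((kernel_action K ^^ n) \<mu>) (cylinder U w) = (\<integral>x. (\<Prod>l\<in>level ` U. pull_iter n l (?f l) x) \<partial>\<mu>)" for n
      unfolding measure_cylinder_eq_integral[OF iterate_borel_probs[OF \<mu>] U]
      by (rule integral_iterate[where t = "\<lambda>l. l", OF \<mu>]) (auto simp: U local_at_indicator_cylinder)
    have eq: "measure \<pi> (cylinder U w) = (\<integral>x. (\<Prod>l\<in>level ` U. mix (p l) (?f l)) \<partial>\<mu>)"
      unfolding measure_cylinder_eq_integral[OF \<pi>B U]
      by (subst mixture_law_integral[OF \<pi>, where t = "\<lambda>l. l"]) (auto simp: U local_at_indicator_cylinder prob_space)
    have "(\<lambda>n. \<integral>x. (\<Prod>l\<in>level ` U. pull_iter (Suc n) l (?f l) x) \<partial>\<mu>) \<longlonglongrightarrow> (\<integral>x. (\<Prod>l\<in>level ` U. mix (p l) (?f l)) \<partial>\<mu>)"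
    proof (rule integral_dominated_convergence)
      show "integrable \<mu> (\<lambda>x. \<Prod>l\<in>level ` U. \<bar>mix (p l) (?f l)\<bar> + \<bar>ev True (?f l) - ev False (?f l)\<bar>)"
        by simp
      show "AE x in \<mu>. (\<lambda>n. \<Prod>l\<in>level ` U. pull_iter (Suc n) l (?f l) x) \<longlonglongrightarrow> (\<Prod>l\<in>level ` U. mix (p l) (?f l))"
        using ins by (intro AE_I2 tendsto_prod) (metis pull_iter_tendsto[OF p])
      show "AE x in \<mu>. norm (\<Prod>l\<in>level ` U. pull_iter (Suc n) l (?f l) x)
          \<le> (\<Prod>l\<in>level ` U. \<bar>mix (p l) (?f l)\<bar> + \<bar>ev True (?f l) - ev False (?f l)\<bar>)" for n
        unfolding real_norm_def abs_prod by (intro AE_I2 prod_mono conjI abs_ge_zero pull_iter_bound[OF p])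
    qed (use meas in \<open>auto simp del: pull_iter.simps intro!: borel_measurable_prod\<close>)
    then show ?thesis
      unfolding eq it[symmetric] by (rule LIMSEQ_imp_Suc)
  qed
  have "\<mu> = \<pi>" if "\<mu> \<in> invariant_probs K" for \<mu>
  proof -
    have \<mu>: "\<mu> \<in> borel_probs" "kernel_action K \<mu> = \<mu>"
      using that by (auto simp: invariant_probs_def)
    have "(kernel_action K ^^ n) \<mu> = \<mu>" for n
      by (induction n) (auto simp: \<mu>(2))
    then show ?thesis
      using conv[OF \<mu>(1)] by (intro config_measure_eqI[OF \<mu>(1) \<pi>B]) (simp add: LIMSEQ_const_iff)
  qed
  then have "invariant_probs K = {\<pi>}"
    using mixture_law_invariant[OF p \<pi>] by blast
  moreover have "converges_weakly (\<lambda>n. (kernel_action K ^^ n) \<mu>) \<pi>" if "\<mu> \<in> borel_probs" for \<mu>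
    by (rule converges_weakly_cylinders[OF iterate_borel_probs[OF that] \<pi>B conv[OF that]])
  ultimately show ?thesis unfolding ergodic_def by blast
qed

end

section \<open>Empirical frequencies\<close>

lemma depends_on_count:
  "depends_on (c ` {..<N}) (\<lambda>x. \<Sum>i<N. of_bool (h (x (c i))) :: real)"
  unfolding depends_on_def by (intro allI impI sum.cong refl) simp

text \<open>Chebyshev's inequality: the centred variables \<open>D i\<close> are uncorrelated and
  bounded by 1, so the second moment of their sum is at most N.\<close>

lemma frequency_deviation:
  assumes P: "product_law q M" and c: "inj_on c {..<N}" and N: "0 < N" and \<delta>: "0 < \<delta>"
    and m: "\<And>i. i < N \<Longrightarrow> (\<Sum>a\<in>UNIV. of_bool (h a) * q (c i) a) = m" "0 \<le> m" "m \<le> 1"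
  shows "(\<integral>x. of_bool (\<delta> \<le> \<bar>(\<Sum>i<N. of_bool (h (x (c i)))) / real N - m\<bar>) \<partial>M) \<le> 1 / (real N * \<delta>\<^sup>2)"
proof -
  note M = product_lawD(1)[OF P]
  interpret prob_space M using borel_probsD[OF M] by simp
  define D where "D i x = of_bool (h (x (c i))) - m" for i and x :: config
  have dep: "depends_on {c i} (D i)" for i
    by (auto simp: depends_on_def D_def)
  have int: "integrable M (\<lambda>x. D i x * D j x)" for i j
    by (rule integrable_depends_on[OF M _ depends_on_mult[OF dep dep]]) simp
  have ED: "(\<integral>x. D i x \<partial>M) = 0" if "i < N" for i
  proof -
    have "integrable M (\<lambda>x. of_bool (h (x (c i))) :: real)"
      by (rule integrable_depends_on[OF M, of "{c i}"]) (auto simp: depends_on_def)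
    then show ?thesis
      unfolding D_def
      using m(1)[OF that] product_law_integral_coordinate[OF P, of "\<lambda>a. of_bool (h a)" "c i"]
      by (simp add: prob_space)
  qed
  have EDD: "(\<integral>x. D i x * D j x \<partial>M) \<le> of_bool (i = j)" if "i < N" "j < N" for i j
  proof (cases "i = j")
    case True
    have "\<bar>D i x\<bar> \<le> 1" for x using m(2,3) by (auto simp: D_def)
    then have "D i x * D i x \<le> 1" for x by (simp add: abs_square_le_1 flip: power2_eq_square)
    then have "(\<integral>x. D i x * D i x \<partial>M) \<le> (\<integral>x. 1 \<partial>M)"
      by (intro integral_mono int) auto
    then show ?thesis using True by (simp add: prob_space)
  next
    case False
    then have "c i \<noteq> c j" using that c by (auto dest: inj_onD)
    then have "(\<integral>x. D i x * D j x \<partial>M) = (\<integral>x. D i x \<partial>M) * (\<integral>x. D j x \<partial>M)"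
      by (intro product_law_integral_mult[OF P _ dep _ dep]) auto
    then show ?thesis using False ED that by simp
  qed
  have "(\<integral>x. (\<Sum>i<N. D i x)\<^sup>2 \<partial>M) = (\<Sum>i<N. \<Sum>j<N. \<integral>x. D i x * D j x \<partial>M)"
    unfolding power2_eq_square sum_product by (simp add: Bochner_Integration.integral_sum int)
  also have "\<dots> \<le> (\<Sum>i<N. \<Sum>j<N. of_bool (i = j))"
    by (intro sum_mono EDD) auto
  also have "\<dots> = real N" by simp
  finally have var: "(\<integral>x. (\<Sum>i<N. D i x)\<^sup>2 \<partial>M) \<le> real N" .
  have sq: "integrable M (\<lambda>x. (\<Sum>i<N. D i x)\<^sup>2)"
    unfolding power2_eq_square sum_product by (intro Bochner_Integration.integrable_sum int)
  have markov: "of_bool (\<delta> \<le> \<bar>(\<Sum>i<N. of_bool (h (x (c i)))) / real N - m\<bar>)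
      \<le> (\<Sum>i<N. D i x)\<^sup>2 / (real N * \<delta>)\<^sup>2" for x
  proof -
    have "(\<Sum>i<N. of_bool (h (x (c i)))) / real N - m = (\<Sum>i<N. D i x) / real N"
      using N by (simp add: D_def sum_subtractf diff_divide_distrib)
    moreover have "1 \<le> (\<Sum>i<N. D i x)\<^sup>2 / (real N * \<delta>)\<^sup>2" if "\<delta> \<le> \<bar>(\<Sum>i<N. D i x) / real N\<bar>"
    proof -
      have "real N * \<delta> \<le> \<bar>\<Sum>i<N. D i x\<bar>"
        using that N by (simp add: abs_divide pos_le_divide_eq mult.commute)
      then have "(real N * \<delta>)\<^sup>2 \<le> \<bar>\<Sum>i<N. D i x\<bar>\<^sup>2"
        using N \<delta> by (intro power_mono) auto
      then show ?thesis using N \<delta> by (simp add: le_divide_eq)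
    qed
    ultimately show ?thesis by auto
  qed
  have "integrable M (\<lambda>x. of_bool (\<delta> \<le> \<bar>(\<Sum>i<N. of_bool (h (x (c i)))) / real N - m\<bar>) :: real)"
    by (rule integrable_depends_on[OF M _ depends_on_comp[OF depends_on_count]]) simp
  then have "(\<integral>x. of_bool (\<delta> \<le> \<bar>(\<Sum>i<N. of_bool (h (x (c i)))) / real N - m\<bar>) \<partial>M)
      \<le> (\<integral>x. (\<Sum>i<N. D i x)\<^sup>2 / (real N * \<delta>)\<^sup>2 \<partial>M)"
    using sq markov by (intro integral_mono) auto
  also have "\<dots> \<le> real N / (real N * \<delta>)\<^sup>2"
    using var by (simp add: divide_right_mono)
  also have "\<dots> = 1 / (real N * \<delta>\<^sup>2)"
    using N by (simp add: power2_eq_square)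
  finally show ?thesis .
qed

section \<open>The concrete signal\<close>

definition frequency :: "(letter \<Rightarrow> bool) \<Rightarrow> nat \<Rightarrow> nat \<Rightarrow> config \<Rightarrow> real" where
  "frequency h N l x = (\<Sum>i<N. of_bool (h (x (prod_encode (l, i))))) / real N"

lemma depends_on_frequency: "depends_on ((\<lambda>i. prod_encode (l, i)) ` {..<N}) (frequency h N l)"
  unfolding frequency_def by (rule depends_on_comp[OF depends_on_count])

definition up :: "nat \<Rightarrow> nat" where
  "up l = (case prod_decode l of (n, k) \<Rightarrow> prod_encode (n, Suc k))"

text \<open>Level \<open>l = prod_encode (n, k)\<close> consists of all cells \<open>prod_encode (l, i)\<close>, but only those with
  \<open>i < 8 ^ k\<close> are read; the others are idle. The factor 2 is there because a first component has
  probability \<open>\<epsilon> / 2\<close> of being true.\<close>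
definition signal :: "(nat \<Rightarrow> real set) \<Rightarrow> nat \<Rightarrow> config \<Rightarrow> bool" where
  "signal C l x = (case prod_decode l of (n, k) \<Rightarrow>
     (\<exists>c\<in>C n. \<bar>2 * frequency fst (8 ^ k) l x - c\<bar> < (1/2) ^ k) \<and> 1/2 < frequency snd (8 ^ k) l x)"

lemma up_encode [simp]: "up (prod_encode (n, k)) = prod_encode (n, Suc k)"
  by (simp add: up_def)

lemma funpow_up: "(up ^^ i) (prod_encode (n, k)) = prod_encode (n, k + i)"
  by (induction i) simp_all

lemma inj_up: "inj up"
proof (rule injI)
  fix l l' assume "up l = up l'"
  moreover obtain n k where "l = prod_encode (n, k)" by (metis prod_decode_inverse surj_pair)
  moreover obtain n' k' where "l' = prod_encode (n', k')" by (metis prod_decode_inverse surj_pair)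
  ultimately show "l = l'" by (simp add: prod_encode_eq)
qed

lemma local_at_signal: "local_at l (signal C l)"
proof -
  obtain n k where nk: "prod_decode l = (n, k)" by fastforce
  let ?U = "(\<lambda>i. prod_encode (l, i)) ` {..<8 ^ k}"
  have "depends_on ?U (signal C l)"
    unfolding depends_on_def
  proof (intro allI impI)
    fix x y :: config assume "\<forall>i\<in>?U. x i = y i"
    then have "frequency h (8 ^ k) l x = frequency h (8 ^ k) l y" for h
      by (intro depends_onD[OF depends_on_frequency]) auto
    then show "signal C l x = signal C l y" by (simp add: signal_def nk)
  qed
  then show ?thesis
    unfolding local_at_def by (intro exI[of _ ?U]) (auto simp: level_def)
qed

lemma signal_chain_signal: "0 \<le> \<epsilon> \<Longrightarrow> \<epsilon> \<le> 1 \<Longrightarrow> signal_chain \<epsilon> up (signal C)"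
  by unfold_locales (auto simp: inj_up local_at_signal)

section \<open>Error probabilities of the signal\<close>

context
  fixes \<epsilon> :: real and C :: "nat \<Rightarrow> real set"
  assumes \<epsilon>: "0 \<le> \<epsilon>" "\<epsilon> \<le> 1"
begin

interpretation signal_chain \<epsilon> up "signal C"
  using \<epsilon> by (rule signal_chain_signal)

lemma ev_frequency_deviation:
  assumes "0 < \<delta>" "(\<Sum>a\<in>UNIV. of_bool (h a) * weight (False, b) a) = m" "0 \<le> m" "m \<le> 1"
  shows "ev b (\<lambda>x. of_bool (\<delta> \<le> \<bar>frequency h (8 ^ k) l x - m\<bar>)) \<le> 1 / (8 ^ k * \<delta>\<^sup>2)"
  using frequency_deviation[OF product_law_block_law[of b], of "\<lambda>i. prod_encode (l, i)" "8 ^ k" \<delta> h m] assms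
  unfolding ev_def frequency_def by (simp add: inj_on_def prod_encode_eq)

lemma fst_deviation:
  assumes "0 < \<delta>"
  shows "ev b (\<lambda>x. of_bool (\<delta> \<le> \<bar>frequency fst (8 ^ k) l x - \<epsilon> / 2\<bar>)) \<le> 1 / (8 ^ k * \<delta>\<^sup>2)"
  using assms \<epsilon> by (intro ev_frequency_deviation) (simp_all add: sum_letter weight_def)

lemma snd_deviation:
  assumes "0 < \<delta>"
  shows "ev b (\<lambda>x. of_bool (\<delta> \<le> \<bar>frequency snd (8 ^ k) l x - ((1 - \<epsilon>) * of_bool b + \<epsilon> / 2)\<bar>))
    \<le> 1 / (8 ^ k * \<delta>\<^sup>2)"
  using assms \<epsilon> by (intro ev_frequency_deviation) (cases b; simp add: sum_letter weight_def)+

lemma integrable_deviation: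
  "integrable (block_law b) (\<lambda>x. of_bool (\<delta> \<le> \<bar>frequency h N l x - m\<bar>) :: real)"
  by (rule integrable_depends_on[OF product_lawD(1)[OF product_law_block_law] _ depends_on_comp[OF depends_on_frequency]])
    simp

text \<open>Passing the test puts twice the frequency within d/2 of a point at distance at least d
  from \<epsilon>, hence the frequency at least d/4 away from its mean \<epsilon>/2.\<close>

lemma act_small_off_target:
  assumes "0 < d" "\<And>c. c \<in> C n \<Longrightarrow> d \<le> \<bar>\<epsilon> - c\<bar>" "(1/2) ^ k \<le> d / 2"
  shows "act b (prod_encode (n, k)) \<le> 16 / (8 ^ k * d\<^sup>2)"
proof -
  let ?l = "prod_encode (n, k)"
  have "d / 4 \<le> \<bar>frequency fst (8 ^ k) ?l x - \<epsilon> / 2\<bar>" if sig: "signal C ?l x" for x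
  proof -
    obtain c where "c \<in> C n" "\<bar>2 * frequency fst (8 ^ k) ?l x - c\<bar> < (1/2) ^ k"
      using sig by (auto simp: signal_def)
    then show ?thesis using assms(2)[of c] assms(3) by linarith
  qed
  then have "act b ?l \<le> ev b (\<lambda>x. of_bool (d / 4 \<le> \<bar>frequency fst (8 ^ k) ?l x - \<epsilon> / 2\<bar>))"
    unfolding act_def ev_def
    by (intro integral_mono integrable_of_bool[OF product_lawD(1)[OF product_law_block_law]] integrable_deviation) auto
  also have "\<dots> \<le> 1 / (8 ^ k * (d / 4)\<^sup>2)"
    using assms(1) by (intro fst_deviation) simp
  also have "\<dots> = 16 / (8 ^ k * d\<^sup>2)"
    by (simp add: power_divide)
  finally show ?thesis .
qed

text \<open>The means for the two bits are \<epsilon>/2 and 1 - \<epsilon>/2. Both lie at distance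
  (1 - \<epsilon>)/2 from the majority threshold, so a misread majority is a deviation of at least
  this size.\<close>

lemma snd_deviation_half:
  assumes "\<epsilon> < 1"
  shows "ev b (\<lambda>x. of_bool ((1 - \<epsilon>) / 2 \<le> \<bar>frequency snd (8 ^ k) l x - ((1 - \<epsilon>) * of_bool b + \<epsilon> / 2)\<bar>))
    \<le> 4 / (1 - \<epsilon>)\<^sup>2 * (1/2) ^ k"
proof -
  have "(1::real) / 8 ^ k \<le> (1/2) ^ k"
    by (simp add: power_one_over power_mono divide_left_mono)
  then have "1 / (8 ^ k * ((1 - \<epsilon>) / 2)\<^sup>2) \<le> 4 / (1 - \<epsilon>)\<^sup>2 * (1/2) ^ k"
    using mult_left_mono[of "1 / 8 ^ k" "(1/2) ^ k" "4 / (1 - \<epsilon>)\<^sup>2"]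
    by (simp add: power_divide mult.commute)
  then show ?thesis
    using assms by (intro order.trans[OF snd_deviation]) auto
qed

lemma act_False_on_target:
  assumes "\<epsilon> < 1"
  shows "act False (prod_encode (n, k)) \<le> 4 / (1 - \<epsilon>)\<^sup>2 * (1/2) ^ k"
proof -
  let ?l = "prod_encode (n, k)"
  have "(1 - \<epsilon>) / 2 \<le> \<bar>frequency snd (8 ^ k) ?l x - ((1 - \<epsilon>) * of_bool False + \<epsilon> / 2)\<bar>" if "signal C ?l x" for x
  proof -
    have "1/2 < frequency snd (8 ^ k) ?l x" using that by (simp add: signal_def)
    then show ?thesis by (simp add: abs_if field_simps)
  qed
  then have "act False ?l \<le> ev False (\<lambda>x. of_bool ((1 - \<epsilon>) / 2 \<le> \<bar>frequency snd (8 ^ k) ?l x - ((1 - \<epsilon>) * of_bool False + \<epsilon> / 2)\<bar>))"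
    unfolding act_def ev_def
    by (intro integral_mono integrable_of_bool[OF product_lawD(1)[OF product_law_block_law]] integrable_deviation) auto
  with snd_deviation_half[OF assms, of False k ?l] show ?thesis by linarith
qed

text \<open>The point \<epsilon> itself serves as witness c in the test. The signal can then fail
  only if the estimate of \<epsilon> is too coarse (\<open>?A\<close>) or the majority is misread
  (\<open>?B\<close>).\<close>

lemma act_True_on_target:
  assumes "\<epsilon> < 1" "\<epsilon> \<in> C n"
  shows "1 - (4 + 4 / (1 - \<epsilon>)\<^sup>2) * (1/2) ^ k \<le> act True (prod_encode (n, k))"
proof -
  let ?l = "prod_encode (n, k)"
  let ?A = "\<lambda>x. (1/2) ^ k / 2 \<le> \<bar>frequency fst (8 ^ k) ?l x - \<epsilon> / 2\<bar>"
  let ?B = "\<lambda>x. (1 - \<epsilon>) / 2 \<le> \<bar>frequency snd (8 ^ k) ?l x - ((1 - \<epsilon>) * of_bool True + \<epsilon> / 2)\<bar>"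
  note M = product_lawD(1)[OF product_law_block_law[of True]]
  interpret prob_space "block_law True" using borel_probsD[OF M] by simp
  have "signal C ?l x" if "\<not> ?A x" "\<not> ?B x" for x
  proof -
    have "\<bar>2 * frequency fst (8 ^ k) ?l x - \<epsilon>\<bar> < (1/2) ^ k"
      using that(1) by linarith
    moreover have "1/2 < frequency snd (8 ^ k) ?l x"
      using that(2) by (simp add: abs_if field_simps split: if_splits)
    ultimately show ?thesis using assms(2) by (auto simp: signal_def)
  qed
  then have "1 - of_bool (?A x) - of_bool (?B x) \<le> (of_bool (signal C ?l x) :: real)" for x
    by (auto simp: of_bool_def)
  moreover define A B where "A x = (of_bool (?A x) :: real)" and "B x = (of_bool (?B x) :: real)" for x
  ultimately have le: "1 - A x - B x \<le> of_bool (signal C ?l x)" for x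
    by simp
  have int: "integrable (block_law True) A" "integrable (block_law True) B"
    unfolding A_def B_def by (rule integrable_deviation)+
  then have "(\<integral>x. 1 - A x - B x \<partial>block_law True) \<le> act True ?l"
    unfolding act_def ev_def by (intro integral_mono integrable_of_bool[OF M] le) auto
  then have "1 - ev True (\<lambda>x. of_bool (?A x)) - ev True (\<lambda>x. of_bool (?B x)) \<le> act True ?l"
    using int unfolding ev_def A_def[symmetric] B_def[symmetric] by (simp add: prob_space)
  moreover have "ev True (\<lambda>x. of_bool (?A x)) \<le> 4 * (1/2) ^ k"
  proof -
    \<comment> \<open>The tolerance of order \<open>(1/2) ^ k\<close> costs a factor
      \<open>4 ^ k\<close> in Chebyshev's bound; a sample of size \<open>8 ^ k\<close> beats it and
      leaves a summable error.\<close>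
    have "(8::real) ^ k = 2 ^ k * 2 ^ k * 2 ^ k" by (simp flip: power_mult_distrib)
    then have "1 / (8 ^ k * ((1/2) ^ k / 2)\<^sup>2) = (4 * (1/2) ^ k :: real)"
      by (simp add: power_one_over power2_eq_square)
    then show ?thesis
      using fst_deviation[of "(1/2) ^ k / 2" True k ?l] by (simp only:) simp
  qed
  ultimately show ?thesis
    using snd_deviation_half[OF assms(1), of True k ?l] unfolding distrib_right by linarith
qed

section \<open>Equilibria off and on the target sets\<close>

text \<open>The update is a convex combination of the two values of \<open>act\<close>. The last two
  bounds say that the error of the incoming bit and the reading error at most add up.\<close>

lemma update_bounds:
  assumes "0 \<le> r" "r \<le> 1"
  shows "0 \<le> act False l + r * (act True l - act False l)" "act False l + r * (act True l - act False l) \<le> 1"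
    "act False l + r * (act True l - act False l) \<le> act False l + r"
    "act True l + r - 1 \<le> act False l + r * (act True l - act False l)"
proof -
  note a = act_bounds[of True l] act_bounds[of False l]
  have *: "act False l + r * (act True l - act False l) = (1 - r) * act False l + r * act True l"
    by (simp add: algebra_simps)
  have "(1 - r) * act False l \<le> (1 - r) * 1" "r * act True l \<le> r * 1"
    using a assms by (intro mult_left_mono; simp)+
  moreover have "0 \<le> (1 - r) * act False l" "0 \<le> r * act True l" "0 \<le> r * act False l"
    "0 \<le> (1 - r) * (1 - act True l)"
    using a assms by simp_all
  ultimately show "0 \<le> act False l + r * (act True l - act False l)" "act False l + r * (act True l - act False l) \<le> 1"
    "act False l + r * (act True l - act False l) \<le> act False l + r"
    "act True l + r - 1 \<le> act False l + r * (act True l - act False l)"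
    by (simp_all add: algebra_simps)
qed

text \<open>The systems n do not interact, so the recursion is solved along each of them separately,
  inside a corridor that the update preserves.\<close>

lemma equilibrium_between:
  fixes lo hi :: "nat \<Rightarrow> nat \<Rightarrow> real"
  assumes le: "\<And>n k. 0 \<le> lo n k" "\<And>n k. lo n k \<le> hi n k" "\<And>n k. hi n k \<le> 1"
    and maps: "\<And>n k r. lo n (Suc k) \<le> r \<Longrightarrow> r \<le> hi n (Suc k) \<Longrightarrow>
      act False (prod_encode (n, Suc k)) + r * (act True (prod_encode (n, Suc k)) - act False (prod_encode (n, Suc k)))
        \<in> {lo n k..hi n k}"
  obtains p where "equilibrium p" "\<And>n k. p (prod_encode (n, k)) \<in> {lo n k..hi n k}"
proof -
  define g where "g n k r = act False (prod_encode (n, Suc k))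
    + r * (act True (prod_encode (n, Suc k)) - act False (prod_encode (n, Suc k)))" for n k r
  have "\<exists>P. (\<forall>k. P k \<in> {lo n k..hi n k}) \<and> (\<forall>k. P k = g n k (P (Suc k)))" for n
  proof (rule backward_recursion_solvable[of "g n" "lo n" "hi n"])
    show "continuous_on UNIV (g n k)" for k
      unfolding g_def by (intro continuous_intros)
    show "g n k r \<in> {lo n k..hi n k}" if "r \<in> {lo n (Suc k)..hi n (Suc k)}" for k r
      unfolding g_def using that by (intro maps) auto
  qed (use le in blast)+
  then obtain P where P: "\<And>n k. P n k \<in> {lo n k..hi n k}" "\<And>n k. P n k = g n k (P n (Suc k))"
    by metis
  define p where "p l = case_prod P (prod_decode l)" for l
  have p: "p (prod_encode (n, k)) = P n k" for n k
    by (simp add: p_def)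
  have "equilibrium p"
    unfolding equilibrium_def
  proof
    fix l
    obtain n k where l: "l = prod_encode (n, k)" by (metis prod_decode_inverse surj_pair)
    have "P n k = g n k (P n (Suc k))" by (rule P(2))
    moreover have "0 \<le> P n k \<and> P n k \<le> 1"
      using P(1)[of n k] le(1)[of n k] le(3)[of n k] by (auto intro: order.trans)
    ultimately show "0 \<le> p l \<and> p l \<le> 1 \<and> p l = act False (up l) + p (up l) * (act True (up l) - act False (up l))"
      unfolding l up_encode p g_def by blast
  qed
  then show thesis using that P(1) p by metis
qed

text \<open>By closedness \<epsilon> has a positive distance d from each \<open>C n\<close>, so deep
  levels of system n rarely emit true, whichever bit they are fed. The depth where this begins may
  depend on the system.\<close>

lemma ergodic_off_target:
  assumes C: "\<And>n. closed (C n)" "\<And>n. \<epsilon> \<notin> C n"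
  shows "ergodic K"
proof -
  obtain p where p: "equilibrium p"
    by (rule equilibrium_between[of "\<lambda>_ _. 0" "\<lambda>_ _. 1"]) (use update_bounds in auto)
  have "\<exists>k0. \<forall>i\<ge>k0. sensitivity ((up ^^ Suc i) l) \<le> 1/2" for l
  proof -
    obtain n k where l: "l = prod_encode (n, k)" by (metis prod_decode_inverse surj_pair)
    obtain d where d: "0 < d" "ball \<epsilon> d \<subseteq> - C n"
      using C[of n] open_contains_ball[of "- C n"] by (auto simp: closed_def)
    have dist: "d \<le> \<bar>\<epsilon> - c\<bar>" if "c \<in> C n" for c
      using that d(2) by (force simp: dist_real_def)
    have "(\<lambda>j. (1/2::real) ^ j) \<longlonglongrightarrow> 0" by (simp add: LIMSEQ_power_zero)
    then have "\<forall>\<^sub>F j in sequentially. (1/2::real) ^ j < d / 2"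
      using d(1) by (intro order_tendstoD(2)) auto
    moreover have "(\<lambda>j. 16 / d\<^sup>2 * (1/8::real) ^ j) \<longlonglongrightarrow> 0"
      by (intro tendsto_mult_right_zero) (simp add: LIMSEQ_power_zero)
    then have "\<forall>\<^sub>F j in sequentially. 16 / d\<^sup>2 * (1/8::real) ^ j < 1/2"
      by (rule order_tendstoD(2)) simp
    ultimately have "\<forall>\<^sub>F j in sequentially. (1/2::real) ^ j < d / 2 \<and> 16 / d\<^sup>2 * (1/8::real) ^ j < 1/2"
      by (rule eventually_conj)
    then obtain k0 where k0: "\<And>j. k0 \<le> j \<Longrightarrow> (1/2::real) ^ j < d / 2 \<and> 16 / d\<^sup>2 * (1/8::real) ^ j < 1/2"
      by (auto simp: eventually_sequentially)
    have "sensitivity ((up ^^ Suc i) l) \<le> 1/2" if "k0 \<le> i" for i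
    proof -
      let ?k = "k + Suc i"
      \<comment> \<open>At this depth both values of \<open>act\<close> lie between 0 and 1/2, hence
        so does their distance.\<close>
      have "(1/2) ^ ?k < d / 2" and small: "16 / d\<^sup>2 * (1/8) ^ ?k < 1/2"
        using k0[of ?k] that by (simp_all del: power_Suc)
      then have "act b (prod_encode (n, ?k)) \<le> 16 / (8 ^ ?k * d\<^sup>2)" for b
        using d(1) dist by (intro act_small_off_target) auto
      moreover have "16 / (8 ^ ?k * d\<^sup>2) = 16 / d\<^sup>2 * (1/8) ^ ?k"
        by (simp add: power_one_over del: power_Suc)
      ultimately have "act b (prod_encode (n, ?k)) \<le> 1/2" for b
        using small by (metis less_eq_real_def order.trans)
      from this[of True] this[of False] act_bounds(1)[of True "prod_encode (n, ?k)"]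
        act_bounds(1)[of False "prod_encode (n, ?k)"]
      show ?thesis
        unfolding l funpow_up sensitivity_def abs_le_iff by (intro conjI) linarith+
    qed
    then show ?thesis by blast
  qed
  then show ?thesis by (rule ergodic_if_insensitive[OF p])
qed

text \<open>One equilibrium is kept near 1 and another near 0 at the deep levels of system n; the
  other systems get the trivial corridor from 0 to 1.\<close>

lemma several_on_target:
  assumes "\<epsilon> < 1" "\<epsilon> \<in> C n"
  shows "\<exists>\<mu> \<nu>. \<mu> \<in> invariant_probs K \<and> \<nu> \<in> invariant_probs K \<and> \<mu> \<noteq> \<nu>"
proof -
  define D where "D = 4 + 4 / (1 - \<epsilon>)\<^sup>2"
  have D: "0 \<le> D" by (simp add: D_def)
  have aT: "1 - D * (1/2) ^ k \<le> act True (prod_encode (n, k))" for k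
    unfolding D_def by (rule act_True_on_target[OF assms])
  have aF: "act False (prod_encode (n, k)) \<le> D * (1/2) ^ k" for k
    by (rule order.trans[OF act_False_on_target[OF assms(1)] mult_right_mono]) (simp_all add: D_def)
  \<comment> \<open>The width r dominates the accumulated reading errors: in units of
    \<open>D * (1/2) ^ k\<close>, the next error is 1/2 and the next width 1, with sum below
    2.\<close>
  define r where "r k = 2 * D * (1/2) ^ k" for k :: nat
  have r: "0 \<le> r k" "D * (1/2) ^ Suc k + r (Suc k) \<le> r k" for k
    using D by (simp_all add: r_def)
  \<comment> \<open>Truncation at 0 keeps the corridor inside the unit interval at shallow levels,
    where r may exceed 1.\<close>
  obtain p where p: "equilibrium p"
    "\<And>m k. p (prod_encode (m, k)) \<in> {(if m = n then max 0 (1 - r k) else 0)..1}"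
  proof (rule equilibrium_between[of "\<lambda>m k. if m = n then max 0 (1 - r k) else 0" "\<lambda>_ _. 1"])
    fix m k x assume x: "(if m = n then max 0 (1 - r (Suc k)) else 0) \<le> x" "x \<le> 1"
    then have "0 \<le> x" by (auto split: if_splits)
    note u = update_bounds[OF this x(2), of "prod_encode (m, Suc k)"]
    show "act False (prod_encode (m, Suc k)) + x * (act True (prod_encode (m, Suc k)) - act False (prod_encode (m, Suc k)))
        \<in> {if m = n then max 0 (1 - r k) else 0..1}"
    proof (cases "m = n")
      case True
      then show ?thesis using u x(1) aT[of "Suc k"] r(2)[of k] by (simp del: power_Suc)
    qed (use u in simp)
  qed (use r in auto)
  obtain q where q: "equilibrium q"
    "\<And>m k. q (prod_encode (m, k)) \<in> {0..(if m = n then min 1 (r k) else 1)}"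
  proof (rule equilibrium_between[of "\<lambda>_ _. 0" "\<lambda>m k. if m = n then min 1 (r k) else 1"])
    fix m k x assume x: "0 \<le> x" "x \<le> (if m = n then min 1 (r (Suc k)) else 1)"
    then have "x \<le> 1" by (auto split: if_splits)
    note u = update_bounds[OF x(1) this, of "prod_encode (m, Suc k)"]
    show "act False (prod_encode (m, Suc k)) + x * (act True (prod_encode (m, Suc k)) - act False (prod_encode (m, Suc k)))
        \<in> {0..if m = n then min 1 (r k) else 1}"
    proof (cases "m = n")
      case True
      then show ?thesis using u x(2) aF[of "Suc k"] r(2)[of k] by (simp del: power_Suc)
    qed (use u in simp)
  qed (use r in auto)
  have "r \<longlonglongrightarrow> 0"
    unfolding r_def by (intro tendsto_mult_right_zero) (simp add: LIMSEQ_power_zero)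
  then obtain k where k: "r k < 1/2"
    using order_tendstoD(2)[of r 0 sequentially "1/2"] by (auto simp: eventually_sequentially)
  \<comment> \<open>At this depth the two corridors lie on opposite sides of 1/2.\<close>
  have "q (prod_encode (n, k)) < p (prod_encode (n, k))"
    using p(2)[of n k] q(2)[of n k] k by simp
  then have "p \<noteq> q" by auto
  then show ?thesis by (rule several_invariant_probs[OF p(1) q(1)])
qed

end

section \<open>The map attached to a given set\<close>

theorem theorem3p19:
  fixes G :: "real set"
  assumes "gdelta_in (top_of_set {0..1}) G"
    and "1 \<in> G"
  shows "\<exists>F :: (nat \<Rightarrow> bool \<times> bool) \<Rightarrow> (nat \<Rightarrow> bool \<times> bool).
    continuous_on UNIV F \<and>
    (\<forall>\<epsilon>\<in>{0..1}.
       (ergodic (perturbation F \<epsilon>) \<longleftrightarrow> \<epsilon> \<in> G) \<and>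
       (\<epsilon> \<notin> G \<longrightarrow>
          (\<exists>\<mu> \<nu>. \<mu> \<in> invariant_probs (perturbation F \<epsilon>) \<and>
                 \<nu> \<in> invariant_probs (perturbation F \<epsilon>) \<and> \<mu> \<noteq> \<nu>))) \<and>
    Uni F = G \<and> Erg F = G"
proof -
  obtain V where "(\<forall>n. openin (top_of_set {0..1}) (V n)) \<and> (\<forall>n. V (Suc n) \<subseteq> V n) \<and> \<Inter>(range V) = G"
    using assms(1) unfolding gdelta_in_descending by (rule exE)
  then have V: "openin (top_of_set {0..1}) (V n)" "\<Inter>(range V) = G" for n
    by simp_all
  define C where "C n = {0..1} - V n" for n :: nat
  have C: "closed (C n)" for n
  proof -
    have "closedin (top_of_set {0..1}) (C n)"
      using closedin_diff[OF closedin_topspace V(1)] by (simp add: C_def)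
    then show ?thesis by (rule closedin_closed_trans) simp
  qed
  have G01: "G \<subseteq> {0..1}"
    using gdelta_in_subset[OF assms(1)] by simp
  have G: "\<epsilon> \<in> G \<longleftrightarrow> (\<forall>n. \<epsilon> \<notin> C n)" if "\<epsilon> \<in> {0..1}" for \<epsilon>
    using that V(2) by (auto simp: C_def)
  \<comment> \<open>The map depends on C but not on \<epsilon>, so one map serves all noise
    levels.\<close>
  let ?F = "signal_chain.F up (signal C)"
  have erg: "ergodic (perturbation ?F \<epsilon>)" if "\<epsilon> \<in> G" for \<epsilon>
    using that G01 G C by (intro ergodic_off_target) auto
  have sev: "\<exists>\<mu> \<nu>. \<mu> \<in> invariant_probs (perturbation ?F \<epsilon>) \<and> \<nu> \<in> invariant_probs (perturbation ?F \<epsilon>) \<and> \<mu> \<noteq> \<nu>"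
    if \<epsilon>: "\<epsilon> \<in> {0..1}" "\<epsilon> \<notin> G" for \<epsilon>
  proof -
    obtain n where "\<epsilon> \<in> C n" using G[OF \<epsilon>(1)] \<epsilon>(2) by blast
    \<comment> \<open>At \<epsilon> = 1 the noise erases every bit; the hypothesis that 1 lies in G
      excludes this case.\<close>
    moreover have "\<epsilon> \<noteq> 1" using \<epsilon>(2) assms(2) by blast
    then have "\<epsilon> < 1" using \<epsilon>(1) by simp
    ultimately show ?thesis using \<epsilon>(1) by (intro several_on_target) auto
  qed
  have imp: "uniquely_ergodic k" if "ergodic k" for k
    using that unfolding ergodic_def uniquely_ergodic_def by auto
  have nuni: "\<not> uniquely_ergodic (perturbation ?F \<epsilon>)" if "\<epsilon> \<in> {0..1}" "\<epsilon> \<notin> G" for \<epsilon>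
    using sev[OF that] unfolding uniquely_ergodic_def by blast
  show ?thesis
  proof (intro exI[of _ ?F] conjI ballI)
    \<comment> \<open>The locale asks for some noise level; 0 will do.\<close>
    show "continuous_on UNIV ?F"
      using signal_chain.continuous_F[OF signal_chain_signal[of 0]] by simp
    show "Uni ?F = G"
      using erg imp nuni G01 by (auto simp: Uni_def)
    show "Erg ?F = G"
      using erg imp nuni G01 by (auto simp: Erg_def)
    fix \<epsilon> :: real assume \<epsilon>: "\<epsilon> \<in> {0..1}"
    show "ergodic (perturbation ?F \<epsilon>) \<longleftrightarrow> \<epsilon> \<in> G"
      using erg imp nuni \<epsilon> by blast
    show "\<epsilon> \<notin> G \<longrightarrow> (\<exists>\<mu> \<nu>. \<mu> \<in> invariant_probs (perturbation ?F \<epsilon>) \<and> \<nu> \<in> invariant_probs (perturbation ?F \<epsilon>) \<and> \<mu> \<noteq> \<nu>)"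
      using sev \<epsilon> by blast
  qed
qed

end
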